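(* Suppose that a periodic, symmetric medium has a bounded defect in $(x_0,x_1)$ that is symmetric, in the sense that $c(x_0+t)=c(x_1-t)$ for all $t\in(0,x_1-x_0)$. Let $u$ be a localised eigenmode of $u''+\frac{\omega^2}{c^2(x)}u=0$ which obeys the homogenisation ansatz with small parameter $\epsilon$ (as defined in the context). Then, when normalised such that $\max_n|u(x_n)|=1$, it satisfies $$|u(x_n)|=\exp\Big(-\big((D_0^L)_{11}-(T_0)_{11}\big)\,|n-1/2|\Big)+O(\epsilon)\qquad\text{for } n\in\mathbb{Z}.$$
   Context: Medium with a bounded defect: let $h>0$ and let $\{x_n:n\in\mathbb{Z}\}\subset\mathbb{R}$ satisfy $x_{n+1}-x_n=h$ for all $n\neq0$, with $x_1-x_0>0$. The function $c:\mathbb{R}\to\mathbb{R}$ is strictly positive and piecewise smooth, with $c(x_n+t)=c(x_m+t)$ and $c(x_n+t)=c(x_{n+1}-t)$ for all $t\in[0,h)$ and $n,m\in\mathbb{Z}\setminus\{0\}$. A localised eigenmode with eigenfrequency $\omega\in\mathbb{R}$ is a nonzero $C^1$ solution $u\in L^2(\mathbb{R})$ of $u''+\frac{\omega^2}{c^2}u=0$ (holding away from discontinuities of $c$) that decays at $\pm\infty$; its frequency lies in a spectral band gap of the medium without defect. Matrices: $T(\omega)\in\mathbb{R}^{2\times 2}$ is the matrix with $(u(x_{n+1}),u'(x_{n+1}))^\top=T(\omega)(u(x_n),u'(x_n))^\top$ for every solution $u$ and every $n\neq0$. $D^L(\omega)$ and $D^R(\omega)$ are the matrices with $(u(x_1),u'(x_1))^\top=D^L(u(x_0),u'(x_0))^\top$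 and $(u(x_0),u'(x_0))^\top=D^R(u(x_1),u'(x_1))^\top$ for every solution $u$. Let $S=\mathrm{diag}(1,-1)$. Small perturbation: $0<\epsilon\ll1$ and $$\epsilon P^L=D^L-T,\qquad \epsilon P^R=SD^RS-T,$$ where the entries of $P^L,P^R\in\mathbb{R}^{2\times2}$ are $O(1)$ as $\epsilon\to0$. Writing $v(x_n)=u'(x_n)$, every solution satisfies, for all $n\in\mathbb{Z}$, $$\begin{pmatrix}u(x_{n+1})+u(x_{n-1})\\ v(x_{n+1})-v(x_{n-1})\end{pmatrix}=2T\begin{pmatrix}u(x_n)\\ 0\end{pmatrix}+\delta_{n,0}\,\epsilon P^L\begin{pmatrix}u(x_n)\\ v(x_n)\end{pmatrix}+\delta_{n,1}\,\epsilon P^R\begin{pmatrix}u(x_n)\\ -v(x_n)\end{pmatrix}.$$ Homogenisation ansatz: put $\eta=\epsilon n$. (i) Up to anti-periodic alternation between adjacent mesh points, $u$ and $v$ are functions of the long-scale variable: relative to the reference point $n$, $u(x_n)=u(\eta)$ and $u(x_{n\pm1})=-u(\eta\pm\epsilon)$, and likewise for $v$. (ii) $u=u_0+\epsilon u_1+\epsilon^2u_2+\dots$ and $v=v_0+\epsilon v_1+\epsilon^2v_2+\dots$, where the terms are continuous functions of $\eta$ varying on the long scale (so their values at points a distance $O(\epsilon)$ apart differ by $O(\epsilon)$), decaying as $\eta\to\pm\infty$, and $u_0\not\equiv0$. (iii) $\omega$ is expanded in powers of $\epsilon$ with leading-order term a value of $\omega$ at an edge of the band gap (where the Bloch waves of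 the medium without defect are anti-periodic). This gives $T(\omega)=T_0+\epsilon T_1+\epsilon^2T_2+\dots$, $P^L(\omega)=P^L_0+O(\epsilon)$ and $P^R(\omega)=P^R_0+O(\epsilon)$, where $T_0,P_0^L,P_0^R$ are the values at the band-gap edge. $D_0^L:=T_0+\epsilon P_0^L$ is the corresponding leading-order value of $D^L$. It is assumed that $-2(T_2)_{11}>0$. (iv) The Kronecker deltas are moved to the long scale by $\delta_{n,0}=\epsilon\delta(\eta)$ and $\delta_{n,1}=\epsilon\delta(\eta-\epsilon)$ with $\delta$ the Dirac distribution, and $u(\eta\pm\epsilon)$, $v(\eta\pm\epsilon)$ are Taylor expanded, so that the difference equation becomes $$\begin{pmatrix}-2u-\epsilon^2u_{\eta\eta}\\ -2\epsilon v_\eta\end{pmatrix}=2T\begin{pmatrix}u\\ 0\end{pmatrix}+\epsilon^2\delta(\eta)P^L\begin{pmatrix}u\\ v\end{pmatrix}+\epsilon^2\delta(\eta-\epsilon)P^R\begin{pmatrix}u\\ -v\end{pmatrix}+O(\epsilon^3).$$ After inserting the expansions in (ii) and (iii), this equation holds, in the sense of distributions in $\eta$, separately at orders $\epsilon^0$, $\epsilon^1$ and $\epsilon^2$, the distributions $\delta(\eta),\delta(\eta-\epsilon)$ being treated as order-one quantities. The term $u_1$, when it is a multiple of $u_0$, is absorbed into $u_0$. *)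

theory Defs
  imports "HOL-Analysis.Analysis" "HOL-Library.Landau_Symbols"
begin

section \<open>Media and modes\<close>

definition smooth_off :: "real set \<Rightarrow> (real \<Rightarrow> real) \<Rightarrow> bool" where
  "smooth_off J f \<longleftrightarrow> (\<forall>k. \<forall>y. y \<notin> J \<longrightarrow> (deriv ^^ k) f differentiable (at y))"

definition piecewise_smooth :: "(real \<Rightarrow> real) \<Rightarrow> bool" where
  "piecewise_smooth f \<longleftrightarrow>
     (\<exists>J. (\<forall>a b. finite (J \<inter> {a..b})) \<and> smooth_off J f \<and>
          (\<forall>k. \<forall>y\<in>J. (\<exists>l. ((deriv ^^ k) f \<longlongrightarrow> l) (at_left y)) \<and>
                        (\<exists>l. ((deriv ^^ k) f \<longlongrightarrow> l) (at_right y))))"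

definition defect_medium :: "real \<Rightarrow> (int \<Rightarrow> real) \<Rightarrow> (real \<Rightarrow> real) \<Rightarrow> bool" where
  "defect_medium h x c \<longleftrightarrow>
     0 < h \<and> (\<forall>n. n \<noteq> 0 \<longrightarrow> x (n + 1) - x n = h) \<and> 0 < x 1 - x 0 \<and>
     (\<forall>y. 0 < c y) \<and> piecewise_smooth c \<and>
     (\<forall>n m. \<forall>t\<in>{0..<h}. n \<noteq> 0 \<longrightarrow> m \<noteq> 0 \<longrightarrow>
        c (x n + t) = c (x m + t) \<and> c (x n + t) = c (x (n + 1) - t))"

definition symmetric_defect :: "(int \<Rightarrow> real) \<Rightarrow> (real \<Rightarrow> real) \<Rightarrow> bool" where
  "symmetric_defect x c \<longleftrightarrow> (\<forall>t\<in>{0<..<x 1 - x 0}. c (x 0 + t) = c (x 1 - t))"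

text \<open>The medium without defect: the unit cell of \<^term>\<open>c\<close> repeated with period \<^term>\<open>h\<close>,
  translated so that its mesh points are the integer multiples of \<^term>\<open>h\<close>.\<close>

definition without_defect :: "real \<Rightarrow> (int \<Rightarrow> real) \<Rightarrow> (real \<Rightarrow> real) \<Rightarrow> real \<Rightarrow> real" where
  "without_defect h x c = (\<lambda>y. c (x 1 + h * frac (y / h)))"

text \<open>\<^term>\<open>u\<close> is a \<open>C\<^sup>1\<close> solution of \<open>u'' + (\<omega>\<^sup>2 / c\<^sup>2) u = 0\<close> and \<^term>\<open>v\<close> is its derivative;
  real-valued for modes, complex-valued for Bloch waves.\<close>

definition solution ::
    "(real \<Rightarrow> real) \<Rightarrow> real \<Rightarrow> (real \<Rightarrow> 'a::real_normed_vector) \<Rightarrow> (real \<Rightarrow> 'a) \<Rightarrow> bool" where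
  "solution c \<omega> u v \<longleftrightarrow>
     (\<forall>y. (u has_vector_derivative v y) (at y)) \<and> continuous_on UNIV v \<and>
     (\<forall>y. isCont c y \<longrightarrow> (v has_vector_derivative - ((\<omega>\<^sup>2 / (c y)\<^sup>2) *\<^sub>R u y)) (at y))"

definition bloch_wave ::
    "real \<Rightarrow> (real \<Rightarrow> real) \<Rightarrow> real \<Rightarrow> (real \<Rightarrow> complex) \<Rightarrow> bool" where
  "bloch_wave h c \<omega> u \<longleftrightarrow>
     (\<exists>v. solution c \<omega> u v) \<and> (\<exists>y. u y \<noteq> 0) \<and> (\<exists>\<alpha>. \<forall>y. u (y + h) = cis \<alpha> * u y)"

definition band_gap :: "real \<Rightarrow> (real \<Rightarrow> real) \<Rightarrow> real set \<Rightarrow> bool" where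
  "band_gap h c G \<longleftrightarrow> G \<in> components (- {\<omega>. \<exists>u. bloch_wave h c \<omega> u})"

definition antiperiodic_edge :: "real \<Rightarrow> (real \<Rightarrow> real) \<Rightarrow> real set \<Rightarrow> real \<Rightarrow> bool" where
  "antiperiodic_edge h c G \<omega> \<longleftrightarrow> \<omega> \<in> frontier G \<and> (\<exists>u. bloch_wave h c \<omega> u) \<and>
     (\<forall>u. bloch_wave h c \<omega> u \<longrightarrow> (\<forall>y. u (y + h) = - u y))"

definition localised_eigenmode ::
    "(real \<Rightarrow> real) \<Rightarrow> real \<Rightarrow> (real \<Rightarrow> real) \<Rightarrow> (real \<Rightarrow> real) \<Rightarrow> bool" where
  "localised_eigenmode c \<omega> u v \<longleftrightarrow>
     solution c \<omega> u v \<and> (\<exists>y. u y \<noteq> 0) \<and> integrable lborel (\<lambda>y. (u y)\<^sup>2) \<and>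
     (u \<longlongrightarrow> 0) at_top \<and> (u \<longlongrightarrow> 0) at_bot"

text \<open>\<^term>\<open>M\<close> is \<^emph>\<open>the\<close> matrix taking the Cauchy data at \<^term>\<open>a\<close> of every solution to those
  at \<^term>\<open>b\<close>. Uniqueness is part of the definition; it expresses that solutions with
  arbitrary Cauchy data exist.\<close>

definition transfer_matrix ::
    "(real \<Rightarrow> real) \<Rightarrow> real \<Rightarrow> real \<Rightarrow> real \<Rightarrow> real^2^2 \<Rightarrow> bool" where
  "transfer_matrix c \<omega> a b M \<longleftrightarrow>
     (\<forall>M'. (\<forall>u v. solution c \<omega> u v \<longrightarrow> vector [u b, v b] = M' *v vector [u a, v a])
            \<longleftrightarrow> M' = M)"

definition S_mat :: "real^2^2" where
  "S_mat = vector [vector [1, 0], vector [0, - 1]]"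

section \<open>Uniform asymptotics\<close>

text \<open>\<open>f(\<epsilon>, z) = O(\<epsilon>\<^sup>k)\<close> as \<open>\<epsilon> \<rightarrow> 0\<close> from above, uniformly in \<open>z\<close>.\<close>

definition unif_O :: "nat \<Rightarrow> (real \<Rightarrow> 'a \<Rightarrow> real) \<Rightarrow> bool" where
  "unif_O k f \<longleftrightarrow> (\<exists>C. \<forall>\<^sub>F \<epsilon> in at_right 0. \<forall>z. \<bar>f \<epsilon> z\<bar> \<le> C * \<epsilon> ^ k)"

text \<open>A term \<open>f(\<epsilon>, \<eta>)\<close> of an expansion: of order one, decaying, continuous and varying on the long
  scale, where jumps at the points of \<open>J \<epsilon>\<close> are allowed; \<open>J = {}\<close> means no jumps. Jumps are needed for
  \<open>v1\<close> (and later terms of \<open>v\<close>) at \<open>0\<close> and \<open>\<epsilon>\<close>: its derivative is balanced against Dirac distributions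
  there, and a continuous \<open>v1\<close> would contradict the other hypotheses. The terms depend
  on \<open>\<epsilon>\<close> because \<open>\<delta>(\<eta> - \<epsilon>)\<close> is kept as an order-one quantity in the equations below.\<close>

definition long_scale :: "real set \<Rightarrow> (real \<Rightarrow> real set) \<Rightarrow> (real \<Rightarrow> real \<Rightarrow> real) \<Rightarrow> bool" where
  "long_scale E J f \<longleftrightarrow>
     unif_O 0 f \<and>
     (\<forall>\<epsilon>\<in>E. continuous_on (- J \<epsilon>) (f \<epsilon>) \<and> (f \<epsilon> \<longlongrightarrow> 0) at_top \<and> (f \<epsilon> \<longlongrightarrow> 0) at_bot) \<and>
     (\<forall>K. \<exists>C. \<forall>\<^sub>F \<epsilon> in at_right 0. \<forall>\<eta> \<eta>'.
        \<bar>\<eta> - \<eta>'\<bar> \<le> K * \<epsilon> \<longrightarrow> closed_segment \<eta> \<eta>' \<inter> J \<epsilon> = {} \<longrightarrow>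
        \<bar>f \<epsilon> \<eta> - f \<epsilon> \<eta>'\<bar> \<le> C * \<epsilon>)"

section \<open>Distributions and the homogenised equations\<close>

definition test_function :: "(real \<Rightarrow> real) \<Rightarrow> bool" where
  "test_function \<phi> \<longleftrightarrow> smooth_off {} \<phi> \<and> compact (closure {y. \<phi> y \<noteq> 0})"

definition reg_dist :: "(real \<Rightarrow> real) \<Rightarrow> (real \<Rightarrow> real) \<Rightarrow> real" where
  "reg_dist f = (\<lambda>\<phi>. integral\<^sup>L lborel (\<lambda>y. f y * \<phi> y))"

definition dist_deriv :: "((real \<Rightarrow> real) \<Rightarrow> real) \<Rightarrow> (real \<Rightarrow> real) \<Rightarrow> real" where
  "dist_deriv \<Lambda> = (\<lambda>\<phi>. - \<Lambda> (deriv \<phi>))"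

definition dirac_at :: "real \<Rightarrow> (real \<Rightarrow> real) \<Rightarrow> real" where
  "dirac_at a = (\<lambda>\<phi>. \<phi> a)"

text \<open>The coefficients of \<open>\<epsilon>\<^sup>0\<close>, \<open>\<epsilon>\<^sup>1\<close> and \<open>\<epsilon>\<^sup>2\<close>, tested against \<open>\<phi>\<close>, in
  \[ (-2u - \epsilon^2 u_{\eta\eta}, -2\epsilon v_\eta) = 2T (u, 0) + \epsilon^2 \delta(\eta) P^L (u, v)
      + \epsilon^2 \delta(\eta - \epsilon) P^R (u, -v) + O(\epsilon^3) \]
  after inserting \<open>u = u0 + \<epsilon> u1 + \<epsilon>\<^sup>2 u2\<close>, \<open>v = v0 + \<epsilon> v1\<close>, \<open>T = T0 + \<epsilon> T1 + \<epsilon>\<^sup>2 T2\<close>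
  and the leading-order values of the two perturbation matrices.\<close>

definition homogenised_equations ::
    "real \<Rightarrow> real^2^2 \<Rightarrow> real^2^2 \<Rightarrow> real^2^2 \<Rightarrow> real^2^2 \<Rightarrow> real^2^2 \<Rightarrow>
     (real \<Rightarrow> real) \<Rightarrow> (real \<Rightarrow> real) \<Rightarrow> (real \<Rightarrow> real) \<Rightarrow>
     (real \<Rightarrow> real) \<Rightarrow> (real \<Rightarrow> real) \<Rightarrow> bool" where
  "homogenised_equations \<epsilon> T0 T1 T2 PL0 PR0 u0 u1 u2 v0 v1 \<longleftrightarrow>
     (\<forall>\<phi>. test_function \<phi> \<longrightarrow>
        vector [- 2 * reg_dist u0 \<phi>, 0]
          = 2 *\<^sub>R (T0 *v vector [reg_dist u0 \<phi>, 0]) \<and>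
        vector [- 2 * reg_dist u1 \<phi>, - 2 * dist_deriv (reg_dist v0) \<phi>]
          = 2 *\<^sub>R (T0 *v vector [reg_dist u1 \<phi>, 0] + T1 *v vector [reg_dist u0 \<phi>, 0]) \<and>
        vector [- 2 * reg_dist u2 \<phi> - dist_deriv (dist_deriv (reg_dist u0)) \<phi>,
                - 2 * dist_deriv (reg_dist v1) \<phi>]
          = 2 *\<^sub>R (T0 *v vector [reg_dist u2 \<phi>, 0] + T1 *v vector [reg_dist u1 \<phi>, 0]
                    + T2 *v vector [reg_dist u0 \<phi>, 0])
            + dirac_at 0 \<phi> *\<^sub>R (PL0 *v vector [u0 0, v0 0])
            + dirac_at \<epsilon> \<phi> *\<^sub>R (PR0 *v vector [u0 \<epsilon>, - v0 \<epsilon>]))"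

end

theory Submission
  imports Defs "HOL-Real_Asymp.Real_Asymp"
begin

text \<open>The leading term \<open>u\<^sub>0\<close> of the envelope satisfies a linear equation of second order with constant
  coefficients and two Dirac sources: eliminating the higher terms from the first components of the
  homogenised equations leaves
  \[ u_0'' = \kappa^2 u_0 - A \delta(\eta) - B \delta(\eta - \epsilon), \qquad \kappa^2 = - 2 (T_2)_{11} > 0, \]
  where \<open>A\<close> and \<open>B\<close> are the first components of \<open>P\<^sup>L\<^sub>0 (u\<^sub>0, v\<^sub>0)\<close> at \<open>0\<close> and \<open>P\<^sup>R\<^sub>0 (u\<^sub>0, - v\<^sub>0)\<close> at \<open>\<epsilon>\<close>
  (\<open>homogenised_first_row\<close>). The only decaying solution is the sum of two exponentials
  \<open>exp (- \<kappa> \<bar>\<eta>\<bar>)\<close> and \<open>exp (- \<kappa> \<bar>\<eta> - \<epsilon>\<bar>)\<close> with weights \<open>A / (2 \<kappa>)\<close> and \<open>B / (2 \<kappa>)\<close>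
  (\<open>delta_forced_solution\<close>). As the equation holds only in the sense of distributions, uniqueness is
  obtained by mollifying with a smooth bump and using the maximum principle for \<open>w'' = \<kappa>\<^sup>2 w\<close>
  (\<open>weak_solution_eq_0\<close>).

  The symmetry of the defect enters through \<open>D\<^sup>L = S D\<^sup>R S\<close>: reflection about the centre of the defect
  maps solutions to solutions (\<open>defect_transfer_matrix_symmetric\<close>). Consequently
  \<open>P\<^sup>L\<^sub>0 = P\<^sup>R\<^sub>0 = P\<close>, and in \<open>A + B = P\<^sub>1\<^sub>1 (u\<^sub>0(0) + u\<^sub>0(\<epsilon>)) + P\<^sub>1\<^sub>2 (v\<^sub>0(0) - v\<^sub>0(\<epsilon>))\<close> the part with
  \<open>v\<^sub>0\<close> is \<open>O(\<epsilon>)\<close>. Since \<open>u\<^sub>0\<close> is \<open>(A + B) / (2 \<kappa>) exp (- \<kappa> \<bar>\<eta>\<bar>)\<close> up to \<open>O(\<epsilon>)\<close>, comparing the values at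
  \<open>0\<close> gives \<open>\<kappa> = P\<^sub>1\<^sub>1 + O(\<epsilon>)\<close>, once the normalisation of the mode shows that its amplitude is
  \<open>1 + O(\<epsilon>)\<close>. On the mesh \<open>\<eta> = \<epsilon> n\<close>, and \<open>\<epsilon> P\<^sub>1\<^sub>1\<close> is the difference of the entries of \<open>D\<^sub>0\<^sup>L\<close> and
  \<open>T\<^sub>0\<close>; replacing \<open>\<bar>n\<bar>\<close> by \<open>\<bar>n - 1/2\<bar>\<close> and \<open>\<kappa>\<close> by \<open>P\<^sub>1\<^sub>1\<close> costs \<open>O(\<epsilon>)\<close> uniformly in \<open>n\<close>
  (\<open>mode_estimate\<close>).\<close>

section \<open>Smooth functions and bumps\<close>

lemma smooth_off_empty_iff:
  "smooth_off {} f \<longleftrightarrow> (\<forall>k y. ((deriv ^^ k) f has_real_derivative deriv ((deriv ^^ k) f) y) (at y))"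
  by (simp add: smooth_off_def DERIV_deriv_iff_real_differentiable)

lemma smooth_has_deriv:
  "smooth_off {} f \<Longrightarrow> (f has_real_derivative deriv f y) (at y)"
  unfolding smooth_off_empty_iff by (drule spec[of _ 0]) simp

lemma smooth_deriv:
  assumes "smooth_off {} f" shows "smooth_off {} (deriv f)"
  unfolding smooth_off_def
proof (intro allI impI)
  fix k y
  have eq: "(deriv ^^ k) (deriv f) = (deriv ^^ Suc k) f" by (simp add: funpow_swap1)
  show "(deriv ^^ k) (deriv f) differentiable at y"
    using assms unfolding smooth_off_def eq by blast
qed

lemma smooth_continuous: "smooth_off {} f \<Longrightarrow> continuous_on S f"
  by (meson smooth_has_deriv DERIV_isCont continuous_at_imp_continuous_on)

text \<open>Smoothness asks for derivatives of every order, so explicit functions are best recognised as smooth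
  through a set of functions that contains its own derivatives. By the sum and product rules it
  suffices to look at generators of an algebra.\<close>

inductive_set function_algebra :: "(real \<Rightarrow> real) set \<Rightarrow> (real \<Rightarrow> real) set"
  for S :: "(real \<Rightarrow> real) set" where
  generator: "f \<in> S \<Longrightarrow> f \<in> function_algebra S"
| const: "(\<lambda>_. a) \<in> function_algebra S"
| add: "f \<in> function_algebra S \<Longrightarrow> g \<in> function_algebra S \<Longrightarrow> (\<lambda>y. f y + g y) \<in> function_algebra S"
| mult: "f \<in> function_algebra S \<Longrightarrow> g \<in> function_algebra S \<Longrightarrow> (\<lambda>y. f y * g y) \<in> function_algebra S"

lemma smooth_function_algebra:
  assumes gen: "\<And>f. f \<in> S \<Longrightarrow> \<exists>f'\<in>function_algebra S. \<forall>y. (f has_real_derivative f' y) (at y)"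
    and f: "f \<in> function_algebra S"
  shows "smooth_off {} f"
proof -
  have step: "\<exists>g'\<in>function_algebra S. \<forall>y. (g has_real_derivative g' y) (at y)"
    if "g \<in> function_algebra S" for g
    using that
  proof induction
    case (generator f)
    then show ?case by (rule gen)
  next
    case (const a)
    have "(\<lambda>_. 0) \<in> function_algebra S" by (rule function_algebra.const)
    then show ?case by (force intro: derivative_eq_intros)
  next
    case (add f g)
    then obtain f' g' where *: "f' \<in> function_algebra S" "g' \<in> function_algebra S"
      "\<And>y. (f has_real_derivative f' y) (at y)" "\<And>y. (g has_real_derivative g' y) (at y)" by blast
    show ?case
      by (rule bexI[OF _ function_algebra.add[OF *(1,2)]]) (auto intro!: DERIV_add *)
  next
    case (mult f g)
    then obtain f' g' where *: "f' \<in> function_algebra S" "g' \<in> function_algebra S"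
      "\<And>y. (f has_real_derivative f' y) (at y)" "\<And>y. (g has_real_derivative g' y) (at y)" by blast
    show ?case
      by (rule bexI[OF _ function_algebra.add[OF function_algebra.mult[OF *(1) mult.hyps(2)]
            function_algebra.mult[OF *(2) mult.hyps(1)]]]) (auto intro!: DERIV_mult *)
  qed
  have iter: "(deriv ^^ k) f \<in> function_algebra S" for k
  proof (induction k)
    case (Suc k)
    then obtain g' where g': "g' \<in> function_algebra S"
        "\<forall>y. ((deriv ^^ k) f has_real_derivative g' y) (at y)"
      using step by blast
    then have "deriv ((deriv ^^ k) f) = g'" by (auto intro: DERIV_imp_deriv)
    then show ?case using g' by simp
  qed (simp add: f)
  show ?thesis
    unfolding smooth_off_def using step[OF iter] real_differentiable_def by blast
qed

text \<open>At \<open>n = 0\<close> this is the classical smooth function that is flat at \<open>0\<close>; the powers of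
  \<open>1 / y\<close> are included because they appear in its derivatives.\<close>

definition flat :: "nat \<Rightarrow> real \<Rightarrow> real" where
  "flat n y = (if 0 < y then inverse y ^ n * exp (- inverse y) else 0)"

lemma flat_has_derivative:
  "(flat n has_real_derivative flat (n + 2) y + - real n * flat (n + 1) y) (at y)"
proof -
  consider "y < 0" | "y = 0" | "0 < y" by linarith
  then show ?thesis
  proof cases
    case 1
    have "((\<lambda>_. 0) has_real_derivative 0) (at y)" by simp
    then have "(flat n has_real_derivative 0) (at y)"
      by (rule has_field_derivative_transform_within_open[of _ _ _ "{..<0}"])
         (use 1 in \<open>auto simp: flat_def\<close>)
    then show ?thesis using 1 by (simp add: flat_def)
  next
    case 2
    have "((\<lambda>x. inverse x ^ (n + 1) / exp (inverse x)) \<longlongrightarrow> 0) (at_right (0::real))"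
      by (rule filterlim_compose[OF tendsto_power_div_exp_0 filterlim_inverse_at_top_right])
    then have "((\<lambda>x. (flat n x - flat n 0) / (x - 0)) \<longlongrightarrow> 0) (at_right 0)"
      by (rule Lim_transform_eventually)
         (auto simp: flat_def eventually_at_right_field exp_minus field_simps intro!: exI[of _ 1])
    moreover have "((\<lambda>x. (flat n x - flat n 0) / (x - 0)) \<longlongrightarrow> 0) (at_left 0)"
      by (rule Lim_transform_eventually[OF tendsto_const])
         (auto simp: flat_def eventually_at_left_field intro!: exI[of _ "-1"])
    ultimately have "((\<lambda>x. (flat n x - flat n 0) / (x - 0)) \<longlongrightarrow> 0) (at 0)"
      by (intro filterlim_split_at)
    then show ?thesis using 2 by (simp add: has_field_derivative_iff flat_def)
  next
    case 3
    have "((\<lambda>y. inverse y ^ n * exp (- inverse y)) has_real_derivative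
            flat (n + 2) y + - real n * flat (n + 1) y) (at y)"
    proof -
      have i: "(inverse has_real_derivative - (inverse y ^ 2)) (at y)"
        using DERIV_inverse[of y] 3 by (simp add: numeral_2_eq_2)
      have e: "((\<lambda>y. exp (- inverse y)) has_real_derivative exp (- inverse y) * inverse y ^ 2) (at y)"
        using DERIV_chain2[OF DERIV_exp DERIV_minus[OF i]] by simp
      have p: "real n * (- (inverse y ^ 2) * inverse y ^ (n - Suc 0)) = - real n * inverse y ^ (n + 1)"
        by (cases n) (simp_all add: power2_eq_square algebra_simps)
      show ?thesis
        using DERIV_mult[OF DERIV_power[OF i, of n] e] 3
        unfolding p by (simp add: flat_def power2_eq_square mult_ac)
    qed
    then show ?thesis
      by (rule has_field_derivative_transform_within_open[of _ _ _ "{0<..}"])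
         (use 3 in \<open>auto simp: flat_def\<close>)
  qed
qed

definition bump :: "real \<Rightarrow> real \<Rightarrow> real" where
  "bump r y = flat 0 (r + y) * flat 0 (r - y)"

lemma bump_bounds: "0 \<le> bump r y" "bump r y \<le> 1"
proof -
  have *: "0 \<le> flat 0 s" "flat 0 s \<le> 1" for s by (auto simp: flat_def)
  show "0 \<le> bump r y" "bump r y \<le> 1"
    unfolding bump_def by (intro mult_nonneg_nonneg mult_le_one *)+
qed

lemma bump_eq_0_iff: "bump r y = 0 \<longleftrightarrow> r \<le> \<bar>y\<bar>"
proof -
  have *: "flat 0 s = 0 \<longleftrightarrow> s \<le> 0" for s unfolding flat_def by (cases "0 < s") auto
  show ?thesis unfolding bump_def mult_eq_0_iff * by (auto simp: abs_if)
qed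

lemma smooth_bump: "smooth_off {} (bump r)"
proof -
  let ?S = "{f. \<exists>n. f = (\<lambda>y. flat n (r + y)) \<or> f = (\<lambda>y. flat n (r - y))}"
  have "\<exists>f'\<in>function_algebra ?S. \<forall>y. (f has_real_derivative f' y) (at y)" if f: "f \<in> ?S" for f
  proof -
    obtain n where "f = (\<lambda>y. flat n (r + y)) \<or> f = (\<lambda>y. flat n (r - y))" using f by blast
    then show ?thesis
    proof
      assume f: "f = (\<lambda>y. flat n (r + y))"
      let ?f' = "\<lambda>y. flat (n + 2) (r + y) + - real n * flat (n + 1) (r + y)"
      have "?f' \<in> function_algebra ?S"
        by (intro function_algebra.add function_algebra.mult function_algebra.const
              function_algebra.generator) blast+
      moreover have "((\<lambda>y. r + y) has_real_derivative 1) (at y)" for y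
        by (auto intro!: derivative_eq_intros)
      from DERIV_chain2[OF flat_has_derivative this]
      have "(f has_real_derivative ?f' y) (at y)" for y unfolding f by simp
      ultimately show ?thesis by (intro bexI[of _ ?f']) auto
    next
      assume f: "f = (\<lambda>y. flat n (r - y))"
      let ?f' = "\<lambda>y. - 1 * (flat (n + 2) (r - y) + - real n * flat (n + 1) (r - y))"
      have "?f' \<in> function_algebra ?S"
        by (intro function_algebra.add function_algebra.mult function_algebra.const
              function_algebra.generator) blast+
      moreover have "((\<lambda>y. r - y) has_real_derivative - 1) (at y)" for y
        by (auto intro!: derivative_eq_intros)
      from DERIV_chain2[OF flat_has_derivative this]
      have "(f has_real_derivative ?f' y) (at y)" for y unfolding f by simp
      ultimately show ?thesis by (intro bexI[of _ ?f']) auto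
    qed
  qed
  moreover have "bump r \<in> function_algebra ?S"
    unfolding bump_def[abs_def]
    by (intro function_algebra.mult function_algebra.generator) blast+
  ultimately show ?thesis by (rule smooth_function_algebra)
qed

lemma smooth_shift:
  assumes "smooth_off {} f"
  shows "smooth_off {} (\<lambda>y. f (y - z))" "deriv (\<lambda>y. f (y - z)) = (\<lambda>y. deriv f (y - z))"
proof -
  have d: "((\<lambda>y. g (y - z)) has_real_derivative deriv g (y - z)) (at y)"
    if "smooth_off {} g" for g y
    by (rule DERIV_chain2[OF smooth_has_deriv[OF that], where g = "\<lambda>y. y - z" and Db = 1, simplified])
       (auto intro!: derivative_eq_intros)
  let ?S = "{f. \<exists>g. smooth_off {} g \<and> f = (\<lambda>y. g (y - z))}"
  show "smooth_off {} (\<lambda>y. f (y - z))"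
  proof (rule smooth_function_algebra[of ?S])
    fix f assume "f \<in> ?S"
    then obtain g where g: "smooth_off {} g" "f = (\<lambda>y. g (y - z))" by blast
    then have "(\<lambda>y. deriv g (y - z)) \<in> function_algebra ?S"
      by (intro function_algebra.generator) (use smooth_deriv in blast)
    then show "\<exists>f'\<in>function_algebra ?S. \<forall>y. (f has_real_derivative f' y) (at y)"
      using d[OF g(1)] unfolding g(2) by (intro bexI) auto
  qed (use assms in \<open>auto intro: function_algebra.generator\<close>)
  show "deriv (\<lambda>y. f (y - z)) = (\<lambda>y. deriv f (y - z))"
    using d[OF assms] by (auto intro: DERIV_imp_deriv)
qed

section \<open>Test functions and regular distributions\<close>

lemma test_function_iff:
  "test_function \<phi> \<longleftrightarrow> smooth_off {} \<phi> \<and> (\<exists>R>0. \<forall>y. R \<le> \<bar>y\<bar> \<longrightarrow> \<phi> y = 0)"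
proof -
  have "compact (closure {y. \<phi> y \<noteq> 0}) \<longleftrightarrow> (\<exists>R>0. \<forall>y. R \<le> \<bar>y\<bar> \<longrightarrow> \<phi> y = 0)"
  proof -
    have "compact (closure {y. \<phi> y \<noteq> 0}) \<longleftrightarrow> bounded {y. \<phi> y \<noteq> 0}" by simp
    also have "\<dots> \<longleftrightarrow> (\<exists>R>0. \<forall>y. R \<le> \<bar>y\<bar> \<longrightarrow> \<phi> y = 0)"
      unfolding bounded_pos_less by (fastforce simp: not_le)
    finally show ?thesis .
  qed
  then show ?thesis by (simp add: test_function_def)
qed

text \<open>A common radius beyond which \<open>\<phi>\<close> and \<open>\<phi>'\<close> both vanish: the derivative is \<open>0\<close> wherever
  \<open>\<phi>\<close> vanishes in a neighbourhood, whence the larger radius in the proof.\<close>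

lemma test_function_support:
  assumes "test_function \<phi>"
  obtains R where "0 < R" "\<And>y. R \<le> \<bar>y\<bar> \<Longrightarrow> \<phi> y = 0" "\<And>y. R \<le> \<bar>y\<bar> \<Longrightarrow> deriv \<phi> y = 0"
proof -
  from assms obtain R where R: "0 < R" "\<And>y. R \<le> \<bar>y\<bar> \<Longrightarrow> \<phi> y = 0"
    by (auto simp: test_function_iff)
  have "deriv \<phi> y = 0" if "R + 1 \<le> \<bar>y\<bar>" for y
  proof (rule DERIV_imp_deriv)
    have o: "open {y. R < \<bar>y\<bar>}" by (intro open_Collect_less continuous_intros)
    show "(\<phi> has_real_derivative 0) (at y)"
      by (rule has_field_derivative_transform_within_open[OF DERIV_const o])
         (use R that in auto)
  qed
  with R show ?thesis by (intro that[of "R + 1"]) auto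
qed

lemma test_function_deriv:
  assumes "test_function \<phi>" shows "test_function (deriv \<phi>)"
proof -
  obtain R where "0 < R" "\<And>y. R \<le> \<bar>y\<bar> \<Longrightarrow> deriv \<phi> y = 0"
    using test_function_support[OF assms] by metis
  moreover have "smooth_off {} (deriv \<phi>)"
    using assms smooth_deriv unfolding test_function_iff by blast
  ultimately show ?thesis unfolding test_function_iff by blast
qed

lemma test_function_shift:
  assumes "test_function \<phi>" shows "test_function (\<lambda>y. \<phi> (y - z))"
proof -
  from assms obtain R where R: "0 < R" "\<And>y. R \<le> \<bar>y\<bar> \<Longrightarrow> \<phi> y = 0"
    unfolding test_function_iff by blast
  have "\<phi> (y - z) = 0" if "R + \<bar>z\<bar> \<le> \<bar>y\<bar>" for y
    using R(2)[of "y - z"] that by linarith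
  moreover have "0 < R + \<bar>z\<bar>" using R(1) by linarith
  moreover have "smooth_off {} (\<lambda>y. \<phi> (y - z))"
    using assms smooth_shift(1) unfolding test_function_iff by blast
  ultimately show ?thesis unfolding test_function_iff by blast
qed

lemma test_function_bump: "0 < r \<Longrightarrow> test_function (bump r)"
  unfolding test_function_iff by (intro conjI smooth_bump exI[of _ r]) (simp_all add: bump_eq_0_iff)

lemma test_function_continuous: "test_function \<phi> \<Longrightarrow> continuous_on S \<phi>"
  by (simp add: test_function_iff smooth_continuous)

text \<open>Pairing with a compactly supported function is an integral over a compact interval. This gives
  access to the fundamental theorem of calculus and to differentiation under the integral sign.\<close>

lemma reg_dist_Icc:
  assumes f: "continuous_on UNIV f" and \<phi>: "test_function \<phi>"
    and supp: "\<And>y. y \<notin> {a..b} \<Longrightarrow> \<phi> y = 0"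
  shows "reg_dist f \<phi> = integral {a..b} (\<lambda>y. f y * \<phi> y)"
    and "integrable lborel (\<lambda>y. f y * \<phi> y)"
proof -
  have eq: "indicator {a..b} y *\<^sub>R (f y * \<phi> y) = f y * \<phi> y" for y
    using supp[of y] by (auto simp: indicator_def)
  have si: "set_integrable lborel {a..b} (\<lambda>y. f y * \<phi> y)"
    by (intro borel_integrable_atLeastAtMost' continuous_intros test_function_continuous \<phi>
          continuous_on_subset[OF f]) auto
  show "integrable lborel (\<lambda>y. f y * \<phi> y)"
    using si by (simp only: set_integrable_def eq)
  show "reg_dist f \<phi> = integral {a..b} (\<lambda>y. f y * \<phi> y)"
    using set_borel_integral_eq_integral(2)[OF si]
    by (simp only: set_lebesgue_integral_def eq reg_dist_def)
qed

lemma reg_dist_integrable: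
  assumes "continuous_on UNIV f" "test_function \<phi>"
  shows "integrable lborel (\<lambda>y. f y * \<phi> y)"
proof -
  obtain R where R: "0 < R" "\<And>y. R \<le> \<bar>y\<bar> \<Longrightarrow> \<phi> y = 0"
    using test_function_support[OF assms(2)] by metis
  have "\<phi> y = 0" if "y \<notin> {- R..R}" for y
    by (rule R(2)) (use that in \<open>unfold atLeastAtMost_iff, linarith\<close>)
  then show ?thesis by (rule reg_dist_Icc(2)[OF assms])
qed

lemma reg_dist_add:
  assumes "continuous_on UNIV f" "continuous_on UNIV g" "test_function \<phi>"
  shows "reg_dist (\<lambda>y. a * f y + b * g y) \<phi> = a * reg_dist f \<phi> + b * reg_dist g \<phi>"
proof -
  have "reg_dist (\<lambda>y. a * f y + b * g y) \<phi>
      = (\<integral>y. (a * (f y * \<phi> y) + b * (g y * \<phi> y)) \<partial>lborel)"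
    unfolding reg_dist_def by (simp add: algebra_simps)
  then show ?thesis
    using reg_dist_integrable[OF assms(1,3)] reg_dist_integrable[OF assms(2,3)]
    by (simp add: reg_dist_def)
qed

lemma reg_dist_cmult: "reg_dist (\<lambda>y. a * f y) \<phi> = a * reg_dist f \<phi>"
  by (simp add: reg_dist_def mult.assoc)

text \<open>A continuous function stays positive near a point where it is positive, so a bump concentrated
  there sees only positive values. Hence a continuous function is determined by its distribution.\<close>

lemma continuous_pos_tested:
  assumes f: "continuous_on UNIV f" and pos: "0 < f z"
  obtains r where "0 < r" "0 < reg_dist f (\<lambda>y. bump r (y - z))"
proof -
  have "isCont f z" using f by (simp add: continuous_on_eq_continuous_at)
  then have "eventually (\<lambda>y. 0 < f y) (nhds z)"
    using pos order_tendstoD(1)[of f "f z" "nhds z" 0] by (simp add: isCont_def tendsto_nhds_iff)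
  then obtain r where r: "0 < r" "\<And>y. dist y z < r \<Longrightarrow> 0 < f y"
    by (auto simp: eventually_nhds_metric)
  let ?g = "\<lambda>y. f y * bump r (y - z)"
  have t: "test_function (\<lambda>y. bump r (y - z))"
    by (intro test_function_shift test_function_bump r)
  have outside: "bump r (y - z) = 0" if "y \<notin> {z - r..z + r}" for y
    using that unfolding bump_eq_0_iff atLeastAtMost_iff by linarith
  have eq: "reg_dist f (\<lambda>y. bump r (y - z)) = integral {z - r..z + r} ?g"
    using outside by (rule reg_dist_Icc(1)[OF f t])
  have c: "continuous_on {z - r..z + r} ?g"
    by (intro continuous_intros test_function_continuous[OF t] continuous_on_subset[OF f]) auto
  have nn: "0 \<le> ?g y" if "y \<in> {z - r..z + r}" for y
  proof (cases "dist y z < r")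
    case True
    then show ?thesis using r(2)[of y] bump_bounds by (simp add: less_imp_le)
  next
    case False
    then show ?thesis by (simp add: bump_eq_0_iff[THEN iffD2] dist_real_def)
  qed
  have "?g z \<noteq> 0" "z - r < z + r" "z \<in> {z - r..z + r}"
    using r(1) pos by (auto simp: bump_eq_0_iff)
  then have "integral {z - r..z + r} ?g \<noteq> 0"
    using integral_eq_0_iff[OF c _ nn] by blast
  moreover have "0 \<le> integral {z - r..z + r} ?g"
    by (rule integral_nonneg[OF integrable_continuous_real[OF c] nn])
  ultimately show ?thesis by (intro that[OF r(1)]) (simp add: eq)
qed

lemma continuous_nonzero_tested:
  assumes f: "continuous_on UNIV f" and nz: "f z \<noteq> 0"
  obtains \<phi> where "test_function \<phi>" "reg_dist f \<phi> \<noteq> 0"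
proof (cases "0 < f z")
  case True
  then obtain r where r: "0 < r" "0 < reg_dist f (\<lambda>y. bump r (y - z))"
    using continuous_pos_tested[OF f] by blast
  show ?thesis
    using r(2) by (intro that[OF test_function_shift[OF test_function_bump[OF r(1)], of z]]) simp
next
  case False
  have "continuous_on UNIV (\<lambda>y. - 1 * f y)" by (intro continuous_intros f)
  then obtain r where r: "0 < r" "0 < reg_dist (\<lambda>y. - 1 * f y) (\<lambda>y. bump r (y - z))"
    using continuous_pos_tested[of "\<lambda>y. - 1 * f y" z] False nz by auto
  show ?thesis
    using r(2) unfolding reg_dist_cmult
    by (intro that[OF test_function_shift[OF test_function_bump[OF r(1)], of z]]) simp
qed

section \<open>Decaying weak solutions\<close>

text \<open>Differentiation under the integral sign. For \<open>z\<close> in a bounded interval all the translates of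
  \<open>\<phi>\<close> are supported in one compact interval, which may then be held fixed.\<close>

lemma mollification_has_derivative:
  assumes f: "continuous_on UNIV f" and \<phi>: "test_function \<phi>"
  shows "((\<lambda>z. reg_dist f (\<lambda>y. \<phi> (y - z))) has_real_derivative
           - reg_dist f (\<lambda>y. deriv \<phi> (y - z))) (at z)"
proof -
  obtain R where R: "0 < R" "\<And>y. R \<le> \<bar>y\<bar> \<Longrightarrow> \<phi> y = 0" "\<And>y. R \<le> \<bar>y\<bar> \<Longrightarrow> deriv \<phi> y = 0"
    using test_function_support[OF \<phi>] by metis
  define a b where "a = z - 1 - R" and "b = z + 1 + R"
  note sm = \<phi>[unfolded test_function_iff, THEN conjunct1]
  have cont: "continuous_on S (\<lambda>p. f (fst (g p)) * \<psi> (fst (g p) - snd (g p)))"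
    if "smooth_off {} \<psi>" "continuous_on S g" for S :: "'b::topological_space set" and g :: "'b \<Rightarrow> real \<times> real" and \<psi>
  proof -
    have "continuous_on S (\<lambda>p. fst (g p))" "continuous_on S (\<lambda>p. fst (g p) - snd (g p))"
      by (intro continuous_intros that(2))+
    then show ?thesis
      by (intro continuous_on_mult continuous_on_compose2[OF f]
            continuous_on_compose2[OF smooth_continuous[OF that(1), of UNIV]]) auto
  qed
  have "((\<lambda>z. integral (cbox a b) (\<lambda>y. f y * \<phi> (y - z))) has_real_derivative
          integral (cbox a b) (\<lambda>y. - (f y * deriv \<phi> (y - z)))) (at z within UNIV)"
  proof (rule leibniz_rule_field_derivative[of UNIV a b "\<lambda>z y. f y * \<phi> (y - z)"
        "\<lambda>z y. - (f y * deriv \<phi> (y - z))"])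
    fix x t
    have "((\<lambda>x. t - x) has_real_derivative - 1) (at x)" by (auto intro!: derivative_eq_intros)
    from DERIV_cmult[OF DERIV_chain2[OF smooth_has_deriv[OF sm] this], of "f t"]
    show "((\<lambda>x. f t * \<phi> (t - x)) has_real_derivative - (f t * deriv \<phi> (t - x))) (at x)"
      by simp
  next
    fix x
    show "(\<lambda>y. f y * \<phi> (y - x)) integrable_on cbox a b"
      by (intro integrable_continuous)
         (use cont[OF sm continuous_on_Pair[OF continuous_on_id continuous_on_const]] in simp)
  next
    show "continuous_on (UNIV \<times> cbox a b) (\<lambda>(z, y). - (f y * deriv \<phi> (y - z)))"
      unfolding case_prod_unfold
      by (intro continuous_on_minus)
         (use cont[OF smooth_deriv[OF sm] continuous_on_Pair[OF continuous_on_snd continuous_on_fst,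
            OF continuous_on_id continuous_on_id]] in simp)
  qed auto
  then have "((\<lambda>z. integral {a..b} (\<lambda>y. f y * \<phi> (y - z))) has_real_derivative
          - integral {a..b} (\<lambda>y. f y * deriv \<phi> (y - z))) (at z)"
    by simp
  moreover have eq: "integral {a..b} (\<lambda>y. f y * \<psi> (y - x)) = reg_dist f (\<lambda>y. \<psi> (y - x))"
    if "x \<in> {z - 1<..<z + 1}" "test_function \<psi>" "\<And>y. R \<le> \<bar>y\<bar> \<Longrightarrow> \<psi> y = 0" for x \<psi>
  proof (rule reg_dist_Icc(1)[OF f test_function_shift[OF that(2)], symmetric])
    fix y assume "y \<notin> {a..b}"
    then have "R \<le> \<bar>y - x\<bar>"
      using that(1) unfolding a_def b_def atLeastAtMost_iff greaterThanLessThan_iff by linarith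
    then show "\<psi> (y - x) = 0" by (rule that(3))
  qed
  ultimately have "((\<lambda>z. integral {a..b} (\<lambda>y. f y * \<phi> (y - z))) has_real_derivative
          - reg_dist f (\<lambda>y. deriv \<phi> (y - z))) (at z)"
    using eq[of z "deriv \<phi>"] test_function_deriv[OF \<phi>] R(3) by simp
  then show ?thesis
    by (rule has_field_derivative_transform_within_open[of _ _ _ "{z - 1<..<z + 1}"])
       (use eq[OF _ \<phi> R(2)] in auto)
qed

lemma mollification_bound:
  assumes f: "continuous_on UNIV f" and r: "0 < r"
    and e: "\<And>y. \<bar>y - z\<bar> \<le> r \<Longrightarrow> \<bar>f y\<bar> \<le> e"
  shows "\<bar>reg_dist f (\<lambda>y. bump r (y - z))\<bar> \<le> e * (2 * r)"
proof -
  note t = test_function_shift[OF test_function_bump[OF r], of z]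
  have "reg_dist f (\<lambda>y. bump r (y - z)) = integral {z - r..z + r} (\<lambda>y. f y * bump r (y - z))"
  proof (rule reg_dist_Icc(1)[OF f t])
    fix y assume "y \<notin> {z - r..z + r}"
    then show "bump r (y - z) = 0" unfolding bump_eq_0_iff atLeastAtMost_iff by linarith
  qed
  also have "norm \<dots> \<le> e * ((z + r) - (z - r))"
  proof (rule integral_bound)
    show "continuous_on {z - r..z + r} (\<lambda>y. f y * bump r (y - z))"
      by (intro continuous_intros test_function_continuous[OF t] continuous_on_subset[OF f]) auto
    fix y assume "y \<in> {z - r..z + r}"
    then have "\<bar>f y\<bar> \<le> e" by (intro e) (auto simp: abs_if)
    then have "\<bar>f y\<bar> * bump r (y - z) \<le> e * 1"
      by (intro mult_mono bump_bounds) auto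
    then show "norm (f y * bump r (y - z)) \<le> e"
      by (simp add: abs_mult bump_bounds)
  qed (use r in auto)
  finally show ?thesis by simp
qed

text \<open>The maximum principle for a function that is a solution of \<open>w'' = k w\<close> only in the sense of
  distributions. Where \<open>w\<close> is positive, a mollification \<open>W\<close> of \<open>w\<close> by a narrow bump is positive as
  well. \<open>W\<close> solves the same equation classically and decays, so it attains a positive maximum; but
  there \<open>W'' = k W > 0\<close>.\<close>

lemma weak_solution_nonpos:
  assumes w: "continuous_on UNIV w" "(w \<longlongrightarrow> 0) at_top" "(w \<longlongrightarrow> 0) at_bot" and k: "0 < k"
    and weak: "\<And>\<phi>. test_function \<phi> \<Longrightarrow> reg_dist w (deriv (deriv \<phi>)) = k * reg_dist w \<phi>"
  shows "w z \<le> 0"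
proof (rule ccontr)
  assume "\<not> w z \<le> 0"
  then obtain r where r: "0 < r" and pos: "0 < reg_dist w (\<lambda>y. bump r (y - z))"
    using continuous_pos_tested[OF w(1), of z] by auto
  define W where "W x = reg_dist w (\<lambda>y. bump r (y - x))" for x
  define W' where "W' x = - reg_dist w (\<lambda>y. deriv (bump r) (y - x))" for x
  note tb = test_function_bump[OF r]
  have sb: "smooth_off {} (bump r)" by (rule smooth_bump)
  have dW: "(W has_real_derivative W' x) (at x)" for x
    unfolding W_def[abs_def] W'_def by (rule mollification_has_derivative[OF w(1) tb])
  have dW': "(W' has_real_derivative k * W x) (at x)" for x
  proof -
    have "(W' has_real_derivative - (- reg_dist w (\<lambda>y. deriv (deriv (bump r)) (y - x)))) (at x)"
      unfolding W'_def[abs_def]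
      by (intro DERIV_minus mollification_has_derivative[OF w(1)] test_function_deriv tb)
    moreover have "deriv (deriv (\<lambda>y. bump r (y - x))) = (\<lambda>y. deriv (deriv (bump r)) (y - x))"
      by (simp only: smooth_shift(2)[OF sb] smooth_shift(2)[OF smooth_deriv[OF sb]])
    ultimately show ?thesis
      using weak[OF test_function_shift[OF tb, of x]] by (simp add: W_def)
  qed
  have Wz: "0 < W z" using pos by (simp add: W_def)
  \<comment> \<open>A bound \<open>e\<close> on \<open>w\<close> over a window of length \<open>2 r\<close> bounds \<open>W\<close> by \<open>2 r e = W z / 2\<close>.\<close>
  define e where "e = W z / (4 * r)"
  have e: "0 < e" using Wz r by (simp add: e_def)
  obtain N1 where N1: "\<And>y. N1 \<le> y \<Longrightarrow> \<bar>w y\<bar> < e"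
    using tendstoD[OF w(2) e] by (auto simp: eventually_at_top_linorder)
  obtain N2 where N2: "\<And>y. y \<le> N2 \<Longrightarrow> \<bar>w y\<bar> < e"
    using tendstoD[OF w(3) e] by (auto simp: eventually_at_bot_linorder)
  define R where "R = \<bar>N1\<bar> + \<bar>N2\<bar> + r + \<bar>z\<bar>"
  have far: "W x < W z" if "R \<le> \<bar>x\<bar>" for x
  proof -
    have "\<bar>w y\<bar> \<le> e" if "\<bar>y - x\<bar> \<le> r" for y
    proof -
      have "N1 \<le> y \<or> y \<le> N2" using that \<open>R \<le> \<bar>x\<bar>\<close> unfolding R_def by linarith
      then show ?thesis using N1[of y] N2[of y] by linarith
    qed
    then have "\<bar>W x\<bar> \<le> e * (2 * r)"
      unfolding W_def by (rule mollification_bound[OF w(1) r])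
    also have "\<dots> = W z / 2" using r by (simp add: e_def)
    finally show ?thesis using Wz by linarith
  qed
  have "continuous_on {- R..R} W"
    by (meson DERIV_isCont continuous_at_imp_continuous_on dW)
  moreover have zR: "z \<in> {- R..R}" unfolding atLeastAtMost_iff R_def using r by linarith
  ultimately obtain m where m: "m \<in> {- R..R}" "\<And>x. x \<in> {- R..R} \<Longrightarrow> W x \<le> W m"
    using continuous_attains_sup[of "{- R..R}" W] by (metis compact_Icc empty_iff)
  have max: "W x \<le> W m" for x
  proof (cases "R \<le> \<bar>x\<bar>")
    case True
    then show ?thesis using far[of x] m(2)[OF zR] by linarith
  next
    case False
    then have "x \<in> {- R..R}" unfolding atLeastAtMost_iff by linarith
    then show ?thesis by (rule m(2))
  qed
  \<comment> \<open>\<open>W'\<close> vanishes at \<open>m\<close> and has positive slope there, so \<open>W\<close> increases to the right of its maximum.\<close>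
  have "W' m = 0" by (rule DERIV_local_max[OF dW, of 1]) (auto intro: max)
  moreover have "0 < k * W m" using k Wz max[of z] by simp
  ultimately obtain d where d: "0 < d" "\<And>t. 0 < t \<Longrightarrow> t < d \<Longrightarrow> 0 < W' (m + t)"
    using DERIV_pos_inc_right[OF dW'[of m]] by auto
  have "W m < W (m + d)"
  proof (rule DERIV_pos_imp_increasing_open[of m "m + d" W])
    fix x assume "m < x" "x < m + d"
    then show "\<exists>y. (W has_real_derivative y) (at x) \<and> 0 < y"
      using dW[of x] d(2)[of "x - m"] by auto
  next
    show "continuous_on {m..m + d} W"
      by (meson DERIV_isCont continuous_at_imp_continuous_on dW)
  qed (use d in simp)
  then show False using max[of "m + d"] by simp
qed

lemma weak_solution_eq_0:
  assumes w: "continuous_on UNIV w" "(w \<longlongrightarrow> 0) at_top" "(w \<longlongrightarrow> 0) at_bot" and k: "0 < k"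
    and weak: "\<And>\<phi>. test_function \<phi> \<Longrightarrow> reg_dist w (deriv (deriv \<phi>)) = k * reg_dist w \<phi>"
  shows "w z = 0"
proof -
  have "- 1 * w z \<le> 0"
  proof (rule weak_solution_nonpos[of "\<lambda>y. - 1 * w y", OF _ _ _ k])
    show "continuous_on UNIV (\<lambda>y. - 1 * w y)" by (intro continuous_intros w)
    show "((\<lambda>y. - 1 * w y) \<longlongrightarrow> 0) at_top" "((\<lambda>y. - 1 * w y) \<longlongrightarrow> 0) at_bot"
      using w(2,3) by (auto intro!: tendsto_eq_intros)
  next
    fix \<phi> :: "real \<Rightarrow> real" assume "test_function \<phi>"
    then show "reg_dist (\<lambda>y. - 1 * w y) (deriv (deriv \<phi>)) = k * reg_dist (\<lambda>y. - 1 * w y) \<phi>"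
      unfolding reg_dist_cmult by (simp add: weak)
  qed
  moreover have "w z \<le> 0" by (rule weak_solution_nonpos[OF w k weak])
  ultimately show ?thesis by linarith
qed

section \<open>Exponential Green functions\<close>

text \<open>The exponential \<open>exp (- \<kappa> \<bar>y - a\<bar>)\<close> solves \<open>G'' = \<kappa>\<^sup>2 G\<close> on each side of \<open>a\<close>, and its slope jumps
  from \<open>\<kappa>\<close> to \<open>- \<kappa>\<close> at \<open>a\<close>; integration by parts turns this jump into the Dirac term.\<close>

lemma exponential_green:
  assumes \<phi>: "test_function \<phi>"
  shows "reg_dist (\<lambda>y. exp (- \<kappa> * \<bar>y - a\<bar>)) (deriv (deriv \<phi>))
       = \<kappa>\<^sup>2 * reg_dist (\<lambda>y. exp (- \<kappa> * \<bar>y - a\<bar>)) \<phi> - 2 * \<kappa> * \<phi> a"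
proof -
  let ?G = "\<lambda>y. exp (- \<kappa> * \<bar>y - a\<bar>)"
  have G: "continuous_on S ?G" for S by (intro continuous_intros)
  obtain R where R: "0 < R" "\<And>y. R \<le> \<bar>y\<bar> \<Longrightarrow> \<phi> y = 0" "\<And>y. R \<le> \<bar>y\<bar> \<Longrightarrow> deriv \<phi> y = 0"
    using test_function_support[OF \<phi>] by metis
  obtain R' where R': "0 < R'" "\<And>y. R' \<le> \<bar>y\<bar> \<Longrightarrow> deriv (deriv \<phi>) y = 0"
    using test_function_support[OF test_function_deriv[OF \<phi>]] by metis
  define M where "M = R + R' + \<bar>a\<bar>"
  have out: "\<phi> y = 0" "deriv \<phi> y = 0" "deriv (deriv \<phi>) y = 0" if "M \<le> \<bar>y\<bar>" for y
    using that R R' unfolding M_def by (auto intro!: R R')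
  have aM: "- M \<le> a" "a \<le> M" using R(1) R'(1) unfolding M_def by linarith+
  note \<phi>' = test_function_deriv[OF \<phi>] and \<phi>'' = test_function_deriv[OF test_function_deriv[OF \<phi>]]
  have d: "(\<phi> has_real_derivative deriv \<phi> y) (at y)"
    "(deriv \<phi> has_real_derivative deriv (deriv \<phi>) y) (at y)" for y
    using \<phi> \<phi>' by (simp_all add: test_function_iff smooth_has_deriv)
  let ?I = "\<lambda>y. ?G y * (deriv (deriv \<phi>) y - \<kappa>\<^sup>2 * \<phi> y)"
  \<comment> \<open>The sign \<open>s\<close> is \<open>1\<close> to the left of \<open>a\<close> and \<open>- 1\<close> to the right of it.\<close>
  have antideriv: "((\<lambda>y. exp (s * \<kappa> * (y - a)) * (deriv \<phi> y - s * \<kappa> * \<phi> y)) has_real_derivative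
        exp (s * \<kappa> * (y - a)) * (deriv (deriv \<phi>) y - \<kappa>\<^sup>2 * \<phi> y)) (at y)" if "s * s = 1" for s y
  proof -
    have "((\<lambda>y. exp (s * \<kappa> * (y - a)) * (deriv \<phi> y - s * \<kappa> * \<phi> y)) has_real_derivative
        exp (s * \<kappa> * (y - a)) * (s * \<kappa>) * (deriv \<phi> y - s * \<kappa> * \<phi> y)
        + exp (s * \<kappa> * (y - a)) * (deriv (deriv \<phi>) y - s * \<kappa> * deriv \<phi> y)) (at y)"
      by (auto intro!: derivative_eq_intros d)
    moreover have "exp (s * \<kappa> * (y - a)) * (s * \<kappa>) * (deriv \<phi> y - s * \<kappa> * \<phi> y)
        + exp (s * \<kappa> * (y - a)) * (deriv (deriv \<phi>) y - s * \<kappa> * deriv \<phi> y)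
        = exp (s * \<kappa> * (y - a)) * (deriv (deriv \<phi>) y - (s * s) * \<kappa>\<^sup>2 * \<phi> y)"
      by (simp add: algebra_simps power2_eq_square)
    ultimately show ?thesis using that by simp
  qed
  have half: "((\<lambda>y. exp (s * \<kappa> * (y - a)) * (deriv (deriv \<phi>) y - \<kappa>\<^sup>2 * \<phi> y)) has_integral
       (exp (s * \<kappa> * (q - a)) * (deriv \<phi> q - s * \<kappa> * \<phi> q)
        - exp (s * \<kappa> * (p - a)) * (deriv \<phi> p - s * \<kappa> * \<phi> p))) {p..q}"
    if "s * s = 1" "p \<le> q" for s p q
    by (rule fundamental_theorem_of_calculus[OF that(2)])
       (use antideriv[OF that(1)] in \<open>auto simp flip: has_real_derivative_iff_has_vector_derivative
          intro: has_field_derivative_at_within\<close>)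
  have "(?I has_integral (deriv \<phi> a - \<kappa> * \<phi> a)) {- M..a}"
  proof (rule has_integral_eq)
    show "((\<lambda>y. exp (1 * \<kappa> * (y - a)) * (deriv (deriv \<phi>) y - \<kappa>\<^sup>2 * \<phi> y)) has_integral
        (deriv \<phi> a - \<kappa> * \<phi> a)) {- M..a}"
      using half[of 1 "- M" a] aM out[of "- M"] by simp
  qed (auto simp: abs_if algebra_simps)
  moreover have "(?I has_integral - (deriv \<phi> a + \<kappa> * \<phi> a)) {a..M}"
  proof (rule has_integral_eq)
    show "((\<lambda>y. exp (- 1 * \<kappa> * (y - a)) * (deriv (deriv \<phi>) y - \<kappa>\<^sup>2 * \<phi> y)) has_integral
        - (deriv \<phi> a + \<kappa> * \<phi> a)) {a..M}"
      using half[of "- 1" a M] aM out[of M] by simp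
  qed auto
  ultimately have "(?I has_integral ((deriv \<phi> a - \<kappa> * \<phi> a) + - (deriv \<phi> a + \<kappa> * \<phi> a))) {- M..M}"
    by (rule has_integral_combine[OF aM])
  then have I: "integral {- M..M} ?I = - 2 * \<kappa> * \<phi> a"
    by (simp add: integral_unique)
  have supp: "\<phi> y = 0" "deriv (deriv \<phi>) y = 0" if "y \<notin> {- M..M}" for y
  proof -
    have "M \<le> \<bar>y\<bar>" using that unfolding atLeastAtMost_iff by linarith
    then show "\<phi> y = 0" "deriv (deriv \<phi>) y = 0" by (simp_all add: out)
  qed
  have e: "reg_dist ?G \<phi> = integral {- M..M} (\<lambda>y. ?G y * \<phi> y)"
    "reg_dist ?G (deriv (deriv \<phi>)) = integral {- M..M} (\<lambda>y. ?G y * deriv (deriv \<phi>) y)"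
    by (rule reg_dist_Icc(1)[OF G], fact, rule supp, assumption)+
  have i: "(\<lambda>y. ?G y * deriv (deriv \<phi>) y) integrable_on {- M..M}"
    "(\<lambda>y. \<kappa>\<^sup>2 * (?G y * \<phi> y)) integrable_on {- M..M}"
    by (intro integrable_continuous_real continuous_intros test_function_continuous \<phi> \<phi>'')+
  have "integral {- M..M} ?I
     = integral {- M..M} (\<lambda>y. ?G y * deriv (deriv \<phi>) y - \<kappa>\<^sup>2 * (?G y * \<phi> y))"
    by (simp add: algebra_simps)
  also have "\<dots> = reg_dist ?G (deriv (deriv \<phi>)) - \<kappa>\<^sup>2 * reg_dist ?G \<phi>"
    unfolding e integral_diff[OF i] by simp
  finally show ?thesis using I by simp
qed

lemma exponential_decay:
  assumes "0 < \<kappa>"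
  shows "((\<lambda>y::real. exp (- \<kappa> * \<bar>y - a\<bar>)) \<longlongrightarrow> 0) at_top" "((\<lambda>y. exp (- \<kappa> * \<bar>y - a\<bar>)) \<longlongrightarrow> 0) at_bot"
  using assms by real_asymp+

text \<open>Subtracting the two Green's functions leaves a decaying solution of the equation without sources,
  which is \<open>0\<close>.\<close>

lemma delta_forced_solution:
  assumes f: "continuous_on UNIV f" "(f \<longlongrightarrow> 0) at_top" "(f \<longlongrightarrow> 0) at_bot" and \<kappa>: "0 < \<kappa>"
    and weak: "\<And>\<phi>. test_function \<phi> \<Longrightarrow>
      reg_dist f (deriv (deriv \<phi>)) = \<kappa>\<^sup>2 * reg_dist f \<phi> - A * \<phi> a - B * \<phi> b"
  shows "f y = A / (2 * \<kappa>) * exp (- \<kappa> * \<bar>y - a\<bar>) + B / (2 * \<kappa>) * exp (- \<kappa> * \<bar>y - b\<bar>)"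
proof -
  define g where "g y = A / (2 * \<kappa>) * exp (- \<kappa> * \<bar>y - a\<bar>) + B / (2 * \<kappa>) * exp (- \<kappa> * \<bar>y - b\<bar>)" for y
  have e: "continuous_on UNIV (\<lambda>y. exp (- \<kappa> * \<bar>y - a\<bar>))" for a by (intro continuous_intros)
  have g: "continuous_on UNIV g" unfolding g_def by (intro continuous_intros)
  have "1 * f y + - 1 * g y = 0"
  proof (rule weak_solution_eq_0[of "\<lambda>y. 1 * f y + - 1 * g y"])
    show "continuous_on UNIV (\<lambda>y. 1 * f y + - 1 * g y)" by (intro continuous_intros f g)
    have "((\<lambda>y. 1 * f y + - 1 * g y) \<longlongrightarrow> 1 * 0 + - 1 * (A / (2 * \<kappa>) * 0 + B / (2 * \<kappa>) * 0)) F"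
      if "(f \<longlongrightarrow> 0) F" "F = at_top \<or> F = at_bot" for F
    proof -
      have "((\<lambda>y. exp (- \<kappa> * \<bar>y - a\<bar>)) \<longlongrightarrow> 0) F" for a
        using that(2) exponential_decay[OF \<kappa>] by blast
      then show ?thesis
        unfolding g_def by (intro tendsto_add tendsto_mult tendsto_const that(1))
    qed
    then show "((\<lambda>y. 1 * f y + - 1 * g y) \<longlongrightarrow> 0) at_top" "((\<lambda>y. 1 * f y + - 1 * g y) \<longlongrightarrow> 0) at_bot"
      using f by simp_all
    show "0 < \<kappa>\<^sup>2" using \<kappa> by simp
  next
    fix \<phi> :: "real \<Rightarrow> real" assume \<phi>: "test_function \<phi>"
    have "reg_dist g (deriv (deriv \<phi>)) = \<kappa>\<^sup>2 * reg_dist g \<phi> - A * \<phi> a - B * \<phi> b"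
      unfolding g_def[abs_def]
      using \<kappa> by (simp only: reg_dist_add[OF e e] \<phi> test_function_deriv exponential_green)
           (simp add: field_simps)
    then show "reg_dist (\<lambda>y. 1 * f y + - 1 * g y) (deriv (deriv \<phi>))
             = \<kappa>\<^sup>2 * reg_dist (\<lambda>y. 1 * f y + - 1 * g y) \<phi>"
      using weak[OF \<phi>]
      by (simp only: reg_dist_add[OF f(1) g] \<phi> test_function_deriv) (simp add: algebra_simps)
  qed
  then show ?thesis by (simp add: g_def)
qed

section \<open>Reflection of a medium with a symmetric defect\<close>

lemma defect_mesh:
  assumes "defect_medium h x c"
  shows "x (1 + int k) = x 1 + real k * h" "x (- int k) = x 0 - real k * h"
proof -
  have step: "x (n + 1) = x n + h" if "n \<noteq> 0" for n
    using assms that unfolding defect_medium_def by (metis add_diff_cancel_left' diff_add_cancel)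
  show "x (1 + int k) = x 1 + real k * h"
  proof (induction k)
    case (Suc k)
    have "x (1 + int (Suc k)) = x ((1 + int k) + 1)" by (simp add: add.commute)
    also have "\<dots> = x (1 + int k) + h" by (rule step) simp
    finally show ?case using Suc by (simp add: algebra_simps)
  qed simp
  show "x (- int k) = x 0 - real k * h"
  proof (induction k)
    case (Suc k)
    have "x (- int k) = x (- int (Suc k) + 1)" by simp
    also have "\<dots> = x (- int (Suc k)) + h" by (rule step) simp
    finally show ?case using Suc by (simp add: algebra_simps)
  qed simp
qed

text \<open>The symmetry of the defect about its midpoint extends to the whole line: a point at distance
  \<open>k h + t\<close> to the right of the defect lies in a cell that is a translate, and by the symmetry of the cell
  also a mirror image, of the one at the same distance to the left.\<close>

lemma symmetric_medium_reflection:
  assumes med: "defect_medium h x c" and sym: "symmetric_defect x c"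
  shows "c (x 0 + x 1 - y) = c y"
proof -
  have right: "c (x 0 + x 1 - y) = c y" if "x 1 \<le> y" for y
  proof -
    have h: "0 < h" using med by (simp add: defect_medium_def)
    define k where "k = nat \<lfloor>(y - x 1) / h\<rfloor>"
    have "0 \<le> (y - x 1) / h" using that h by simp
    then have "real k = of_int \<lfloor>(y - x 1) / h\<rfloor>" by (simp add: k_def)
    then have "real k \<le> (y - x 1) / h" "(y - x 1) / h < real k + 1"
      using floor_correct[of "(y - x 1) / h"] by linarith+
    then have k: "real k * h \<le> y - x 1" "y - x 1 < (real k + 1) * h"
      using h by (simp_all only: pos_le_divide_eq pos_divide_less_eq)
    define t where "t = y - x 1 - real k * h"
    have t: "t \<in> {0..<h}" using k by (simp add: t_def ring_distribs)
    have cell: "c (x n + t) = c (x n' + t)" "c (x n + t) = c (x (n + 1) - t)"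
      if "n \<noteq> 0" "n' \<noteq> 0" for n n'
      using med t that unfolding defect_medium_def by blast+
    have "c y = c (x (1 + int k) + t)" by (simp add: defect_mesh(1)[OF med] t_def)
    also have "\<dots> = c (x (- int k - 1) + t)" by (rule cell(1)) auto
    also have "\<dots> = c (x (- int k) - t)" using cell(2)[of "- int k - 1" 1] by simp
    also have "x (- int k) - t = x 0 + x 1 - y" by (simp add: defect_mesh(2)[OF med] t_def)
    finally show ?thesis by simp
  qed
  consider "x 1 \<le> y" | "y \<le> x 0" | "x 0 < y" "y < x 1" by linarith
  then show ?thesis
  proof cases
    case 2
    then show ?thesis using right[of "x 0 + x 1 - y"] by simp
  next
    case 3
    then have "y - x 0 \<in> {0<..<x 1 - x 0}" by simp
    then have "c (x 0 + (y - x 0)) = c (x 1 - (y - x 0))"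
      using sym unfolding symmetric_defect_def by blast
    then show ?thesis by (simp add: algebra_simps)
  qed (rule right)
qed

lemma solution_reflection:
  fixes u v :: "real \<Rightarrow> real"
  assumes c: "\<And>y. c (\<sigma> - y) = c y" and sol: "solution c \<omega> u v"
  shows "solution c \<omega> (\<lambda>y. u (\<sigma> - y)) (\<lambda>y. - v (\<sigma> - y))"
proof -
  have r: "((\<lambda>y. \<sigma> - y) has_real_derivative - 1) (at y)" for y
    by (auto intro!: derivative_eq_intros)
  have du: "(u has_real_derivative v y) (at y)" for y
    using sol unfolding solution_def has_real_derivative_iff_has_vector_derivative by blast
  have dv: "(v has_real_derivative - (\<omega>\<^sup>2 / (c y)\<^sup>2 * u y)) (at y)" if "isCont c y" for y
    using sol that unfolding solution_def has_real_derivative_iff_has_vector_derivative real_scaleR_def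
    by blast
  have cv: "continuous_on UNIV v" using sol unfolding solution_def by blast
  have "((\<lambda>y. u (\<sigma> - y)) has_real_derivative - v (\<sigma> - y)) (at y)" for y
    using DERIV_chain2[OF du r] by simp
  moreover have "continuous_on UNIV (\<lambda>y. - v (\<sigma> - y))"
    by (intro continuous_intros continuous_on_compose2[OF cv]) auto
  moreover have "((\<lambda>y. - v (\<sigma> - y)) has_real_derivative - (\<omega>\<^sup>2 / (c y)\<^sup>2 * u (\<sigma> - y))) (at y)"
    if "isCont c y" for y
  proof -
    have "isCont (\<lambda>z. c (\<sigma> - z)) (\<sigma> - y)"
      by (rule isCont_o2[of _ "\<lambda>z. \<sigma> - z"]) (simp_all add: that)
    then have "isCont c (\<sigma> - y)" unfolding c .
    from DERIV_minus[OF DERIV_chain2[OF dv[OF this] r]]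
    show ?thesis unfolding c by simp
  qed
  ultimately show ?thesis
    unfolding solution_def has_real_derivative_iff_has_vector_derivative real_scaleR_def mult_minus_right
      minus_minus
    by blast
qed

lemma S_mat_vector: "S_mat *v vector [a, b] = vector [a, - b]"
  by (simp add: vec_eq_iff forall_2 S_mat_def matrix_vector_mult_def sum_2)

lemma transfer_matrixD:
  assumes "transfer_matrix c \<omega> a b M" "solution c \<omega> u v"
  shows "vector [u b, v b] = M *v vector [u a, v a]"
  using assms(1)[unfolded transfer_matrix_def, THEN spec, of M] assms(2) by blast

lemma transfer_matrix_unique:
  assumes "transfer_matrix c \<omega> a b M"
    and "\<And>u v. solution c \<omega> u v \<Longrightarrow> vector [u b, v b] = M' *v vector [u a, v a]"
  shows "M' = M"
  using assms(1)[unfolded transfer_matrix_def, THEN spec, of M'] assms(2) by blast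

text \<open>Reflection exchanges the two ends of the defect and reverses the sign of the derivative, so
  crossing the defect from right to left is conjugate by \<open>S\<close> to crossing it from left to right.\<close>

lemma defect_transfer_matrix_symmetric:
  assumes "defect_medium h x c" and "symmetric_defect x c"
    and DL: "transfer_matrix c \<omega> (x 0) (x 1) DL" and DR: "transfer_matrix c \<omega> (x 1) (x 0) DR"
  shows "DL = S_mat ** DR ** S_mat"
proof -
  have "vector [u (x 1), v (x 1)] = (S_mat ** DR ** S_mat) *v vector [u (x 0), v (x 0)]"
    if "solution c \<omega> u v" for u v
  proof -
    have "solution c \<omega> (\<lambda>y. u (x 0 + x 1 - y)) (\<lambda>y. - v (x 0 + x 1 - y))"
      by (rule solution_reflection[OF symmetric_medium_reflection[OF assms(1,2)] that])
    from transfer_matrixD[OF DR this]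
    have "vector [u (x 1), - v (x 1)] = DR *v vector [u (x 0), - v (x 0)]" by simp
    then have "S_mat *v vector [u (x 1), - v (x 1)]
        = S_mat *v (DR *v (S_mat *v vector [u (x 0), v (x 0)]))"
      by (simp add: S_mat_vector)
    also have "\<dots> = (S_mat ** DR ** S_mat) *v vector [u (x 0), v (x 0)]"
      by (simp only: matrix_vector_mul_assoc matrix_mul_assoc)
    finally show ?thesis by (simp only: S_mat_vector minus_minus)
  qed
  then show ?thesis by (rule transfer_matrix_unique[OF DL, symmetric])
qed

section \<open>Amplitude and decay rate\<close>

lemma exp_minus_lipschitz:
  fixes s t :: real
  assumes "0 \<le> s" "0 \<le> t"
  shows "\<bar>exp (- s) - exp (- t)\<bar> \<le> \<bar>s - t\<bar>"
proof -
  have *: "\<bar>exp (- s) - exp (- t)\<bar> \<le> t - s" if "0 \<le> s" "s \<le> t" for s t :: real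
  proof -
    have "exp (- s) - exp (- t) = exp (- s) * (1 - exp (- (t - s)))"
      by (simp add: algebra_simps flip: exp_add)
    also have "\<dots> \<le> 1 * (t - s)"
    proof (rule mult_mono)
      show "1 - exp (- (t - s)) \<le> t - s"
        using exp_ge_add_one_self[of "- (t - s)"] by linarith
    qed (use that in auto)
    finally show ?thesis using that by (simp add: abs_if)
  qed
  show ?thesis
    using *[of s t] *[of t s] assms by (cases "s \<le> t") (auto simp: abs_minus_commute)
qed

text \<open>Changing the rate has an effect that is small uniformly in \<open>t\<close>, although \<open>(\<kappa> - p) t\<close> is unbounded: half of the decay
  is kept in reserve, and \<open>t exp (- \<kappa> t / 2) \<le> 2 / \<kappa>\<close>.\<close>

lemma exp_rate_lipschitz:
  fixes \<kappa> p t :: real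
  assumes "0 < \<kappa>" "\<kappa> / 2 \<le> p" "0 \<le> t"
  shows "\<bar>exp (- \<kappa> * t) - exp (- p * t)\<bar> \<le> 2 / \<kappa> * \<bar>\<kappa> - p\<bar>"
proof -
  let ?\<mu> = "\<kappa> / 2"
  have "exp (- \<kappa> * t) - exp (- p * t)
      = exp (- (?\<mu> * t)) * (exp (- ((\<kappa> - ?\<mu>) * t)) - exp (- ((p - ?\<mu>) * t)))"
    by (simp add: algebra_simps flip: exp_add)
  then have "\<bar>exp (- \<kappa> * t) - exp (- p * t)\<bar>
      = exp (- (?\<mu> * t)) * \<bar>exp (- ((\<kappa> - ?\<mu>) * t)) - exp (- ((p - ?\<mu>) * t))\<bar>"
    by (simp add: abs_mult)
  also have "\<dots> \<le> exp (- (?\<mu> * t)) * \<bar>(\<kappa> - ?\<mu>) * t - (p - ?\<mu>) * t\<bar>"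
    using assms by (intro mult_left_mono exp_minus_lipschitz mult_nonneg_nonneg) auto
  also have "(\<kappa> - ?\<mu>) * t - (p - ?\<mu>) * t = (\<kappa> - p) * t" by (simp add: algebra_simps)
  also have "exp (- (?\<mu> * t)) * \<bar>(\<kappa> - p) * t\<bar> = (t * exp (- (?\<mu> * t))) * \<bar>\<kappa> - p\<bar>"
    using assms by (simp add: abs_mult)
  also have "\<dots> \<le> 2 / \<kappa> * \<bar>\<kappa> - p\<bar>"
  proof (rule mult_right_mono)
    have "?\<mu> * t \<le> exp (?\<mu> * t)" using exp_ge_add_one_self[of "?\<mu> * t"] by linarith
    then show "t * exp (- (?\<mu> * t)) \<le> 2 / \<kappa>"
      using assms by (simp add: exp_minus field_simps)
  qed simp
  finally show ?thesis .
qed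

text \<open>The quantitative heart of the argument for one value of \<open>\<epsilon>\<close>. The two sources of \<open>f\<close> are a distance
  \<open>\<epsilon>\<close> apart, so up to \<open>O(\<epsilon>)\<close> the function is a single exponential \<open>a exp (- \<kappa> \<bar>y\<bar>)\<close>. The normalisation
  on the mesh forces \<open>\<bar>a\<bar> = 1 + O(\<epsilon>)\<close>. The strengths \<open>A\<close> and \<open>B\<close> depend on \<open>f\<close> itself: as \<open>f\<close> and the
  derivative hardly vary over the distance \<open>\<epsilon>\<close>, the contributions of \<open>q\<close> cancel up to \<open>O(\<epsilon>)\<close> and \<open>2 \<kappa> a = A + B = 2 p a + O(\<epsilon>)\<close>, which
  identifies the rate \<open>\<kappa>\<close> with \<open>p\<close>. Here \<open>g\<^sub>0\<close> and \<open>g\<^sub>1\<close> are the values at \<open>0\<close> and \<open>\<epsilon>\<close> of the leading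
  term of the derivative, and \<open>K\<close> is a common bound for everything of order one.\<close>

lemma mode_estimate:
  fixes \<kappa> K \<epsilon> p q A B g\<^sub>0 g\<^sub>1 :: real and f :: "real \<Rightarrow> real" and m :: "int \<Rightarrow> real"
  assumes \<kappa>: "0 < \<kappa>" and \<epsilon>: "0 < \<epsilon>" and K: "1 \<le> K"
    and f: "\<And>y. f y = A / (2 * \<kappa>) * exp (- \<kappa> * \<bar>y - 0\<bar>) + B / (2 * \<kappa>) * exp (- \<kappa> * \<bar>y - \<epsilon>\<bar>)"
    and A: "A = p * f 0 + q * g\<^sub>0" and B: "B = p * f \<epsilon> - q * g\<^sub>1"
    and bounds: "\<bar>p\<bar> \<le> K" "\<bar>q\<bar> \<le> K" "\<bar>f \<epsilon>\<bar> \<le> K" "\<bar>g\<^sub>1\<bar> \<le> K"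
    and slow: "\<bar>f 0 - f \<epsilon>\<bar> \<le> K * \<epsilon>" "\<bar>g\<^sub>0 - g\<^sub>1\<bar> \<le> K * \<epsilon>"
    and m: "\<And>n. \<bar>m n - \<bar>f (\<epsilon> * of_int n)\<bar>\<bar> \<le> K * \<epsilon>" "\<And>n. m n \<le> 1" "\<exists>n. m n = 1"
    and small: "(K + K\<^sup>2) * \<epsilon> \<le> 1 / 2" "(2 * K ^ 3 + 2 * K\<^sup>2) * \<epsilon> \<le> \<kappa> / 2"
  shows "\<bar>m n - exp (- (\<epsilon> * p) * \<bar>of_int n - 1 / 2\<bar>)\<bar>
       \<le> (2 * (K + K\<^sup>2) + \<kappa> / 2 + 2 / \<kappa> * (2 * K ^ 3 + 2 * K\<^sup>2)) * \<epsilon>"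
proof -
  define a where "a = (A + B) / (2 * \<kappa>)"
  define L where "L = K + K\<^sup>2"
  define N where "N = 2 * K ^ 3 + 2 * K\<^sup>2"
  have K0: "0 \<le> K" using K by simp
  have "\<bar>B\<bar> \<le> \<bar>p\<bar> * \<bar>f \<epsilon>\<bar> + \<bar>q\<bar> * \<bar>g\<^sub>1\<bar>"
    unfolding B abs_mult[symmetric] by (rule abs_triangle_ineq4)
  also have "\<dots> \<le> K * K + K * K"
    by (intro add_mono mult_mono bounds K0 abs_ge_zero)
  finally have Bb: "\<bar>B\<bar> \<le> 2 * K\<^sup>2" by (simp add: power2_eq_square)
  have fa: "\<bar>f y - a * exp (- \<kappa> * \<bar>y\<bar>)\<bar> \<le> K\<^sup>2 * \<epsilon>" for y
  proof -
    have "f y - a * exp (- \<kappa> * \<bar>y\<bar>) = B / (2 * \<kappa>) * (exp (- (\<kappa> * \<bar>y - \<epsilon>\<bar>)) - exp (- (\<kappa> * \<bar>y\<bar>)))"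
      unfolding f a_def by (simp add: add_divide_distrib ring_distribs)
    then have "\<bar>f y - a * exp (- \<kappa> * \<bar>y\<bar>)\<bar>
        = \<bar>B\<bar> / (2 * \<kappa>) * \<bar>exp (- (\<kappa> * \<bar>y - \<epsilon>\<bar>)) - exp (- (\<kappa> * \<bar>y\<bar>))\<bar>"
      using \<kappa> by (simp add: abs_mult)
    also have "\<dots> \<le> 2 * K\<^sup>2 / (2 * \<kappa>) * \<bar>\<kappa> * \<bar>y - \<epsilon>\<bar> - \<kappa> * \<bar>y\<bar>\<bar>"
      using \<kappa> by (intro mult_mono divide_right_mono Bb exp_minus_lipschitz) auto
    also have "\<dots> \<le> 2 * K\<^sup>2 / (2 * \<kappa>) * (\<kappa> * \<epsilon>)"
    proof (intro mult_left_mono)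
      have "\<bar>\<kappa> * \<bar>y - \<epsilon>\<bar> - \<kappa> * \<bar>y\<bar>\<bar> = \<kappa> * \<bar>\<bar>y - \<epsilon>\<bar> - \<bar>y\<bar>\<bar>"
        using \<kappa> by (simp add: abs_mult flip: right_diff_distrib)
      also have "\<dots> \<le> \<kappa> * \<epsilon>" using \<kappa> \<epsilon> by (intro mult_left_mono) auto
      finally show "\<bar>\<kappa> * \<bar>y - \<epsilon>\<bar> - \<kappa> * \<bar>y\<bar>\<bar> \<le> \<kappa> * \<epsilon>" .
    qed (use \<kappa> in auto)
    also have "\<dots> = K\<^sup>2 * \<epsilon>" using \<kappa> by simp
    finally show ?thesis .
  qed
  define X where "X k = exp (- \<kappa> * \<bar>\<epsilon> * of_int k\<bar>)" for k :: int
  have X: "0 \<le> X k" "X k \<le> 1" for k using \<kappa> by (simp_all add: X_def)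
  have ma: "\<bar>m k - \<bar>a\<bar> * X k\<bar> \<le> L * \<epsilon>" for k
  proof -
    have "\<bar>f (\<epsilon> * of_int k) - a * X k\<bar> \<le> K\<^sup>2 * \<epsilon>" unfolding X_def by (rule fa)
    moreover have "\<bar>a * X k\<bar> = \<bar>a\<bar> * X k" using X(1)[of k] by (simp add: abs_mult)
    ultimately show ?thesis using m(1)[of k] unfolding L_def ring_distribs by linarith
  qed
  \<comment> \<open>The lower bound comes from the mesh point where the mode has modulus \<open>1\<close>, the upper one from \<open>n = 0\<close>.\<close>
  have a1: "\<bar>\<bar>a\<bar> - 1\<bar> \<le> L * \<epsilon>"
  proof -
    obtain k where k: "m k = 1" using m(3) by blast
    have "\<bar>a\<bar> * X k \<le> \<bar>a\<bar> * 1" by (intro mult_left_mono X) auto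
    moreover have "1 - L * \<epsilon> \<le> \<bar>a\<bar> * X k" using ma[of k] k by linarith
    moreover have "X 0 = 1" by (simp add: X_def)
    then have "\<bar>a\<bar> - L * \<epsilon> \<le> 1" using ma[of 0] m(2)[of 0] by simp
    ultimately show ?thesis by linarith
  qed
  \<comment> \<open>Since \<open>\<bar>a\<bar> \<ge> 1 / 2\<close>, the relation \<open>2 \<kappa> a = 2 p a + O(\<epsilon>)\<close> can be divided by \<open>a\<close>.\<close>
  have rate: "\<bar>\<kappa> - p\<bar> \<le> N * \<epsilon>"
  proof -
    have "2 * a * \<kappa> = A + B" using \<kappa> by (simp add: a_def)
    also have "\<dots> = p * (f 0 + f \<epsilon>) + q * (g\<^sub>0 - g\<^sub>1)"
      unfolding A B by (simp add: ring_distribs)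
    finally have "2 * a * \<kappa> = p * (f 0 + f \<epsilon>) + q * (g\<^sub>0 - g\<^sub>1)" .
    then have "2 * a * (\<kappa> - p) = p * (f 0 + f \<epsilon> - 2 * a) + q * (g\<^sub>0 - g\<^sub>1)"
      by (simp add: ring_distribs)
    then have "\<bar>2 * a * (\<kappa> - p)\<bar> \<le> \<bar>p\<bar> * \<bar>f 0 + f \<epsilon> - 2 * a\<bar> + \<bar>q\<bar> * \<bar>g\<^sub>0 - g\<^sub>1\<bar>"
      using abs_triangle_ineq by (simp only: abs_mult[symmetric])
    also have "\<dots> \<le> K * (2 * K\<^sup>2 * \<epsilon> + K * \<epsilon>) + K * (K * \<epsilon>)"
    proof (intro add_mono mult_mono bounds slow K0 abs_ge_zero)
      have "\<bar>f 0 - a\<bar> \<le> K\<^sup>2 * \<epsilon>" using fa[of 0] by simp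
      then show "\<bar>f 0 + f \<epsilon> - 2 * a\<bar> \<le> 2 * K\<^sup>2 * \<epsilon> + K * \<epsilon>"
        using slow(1) by linarith
    qed
    also have "\<dots> = N * \<epsilon>" by (simp add: N_def algebra_simps power2_eq_square power3_eq_cube)
    finally have N: "2 * \<bar>a\<bar> * \<bar>\<kappa> - p\<bar> \<le> N * \<epsilon>" by (simp only: abs_mult abs_numeral)
    have "1 \<le> 2 * \<bar>a\<bar>" using a1 small(1) unfolding L_def[symmetric] by linarith
    then have "1 * \<bar>\<kappa> - p\<bar> \<le> 2 * \<bar>a\<bar> * \<bar>\<kappa> - p\<bar>" by (intro mult_right_mono) auto
    from order_trans[OF this N] show ?thesis by simp
  qed
  have p: "\<kappa> / 2 \<le> p" using rate small(2) unfolding N_def[symmetric] by linarith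
  define t where "t = \<epsilon> * \<bar>of_int n - 1 / 2\<bar>"
  have t: "0 \<le> t" using \<epsilon> by (simp add: t_def)
  define Y where "Y = exp (- \<kappa> * t)"
  define Z where "Z = exp (- p * t)"
  have "\<bar>m n - X n\<bar> \<le> L * \<epsilon> + L * \<epsilon>"
  proof -
    have "\<bar>\<bar>a\<bar> * X n - X n\<bar> = \<bar>\<bar>a\<bar> - 1\<bar> * X n"
      using X(1)[of n] abs_mult[of "\<bar>a\<bar> - 1" "X n"] by (simp add: left_diff_distrib)
    also have "\<dots> \<le> (L * \<epsilon>) * 1" using a1 X by (intro mult_mono) auto
    finally show ?thesis using ma[of n] by linarith
  qed
  moreover have "\<bar>X n - Y\<bar> \<le> \<kappa> / 2 * \<epsilon>"
  proof -
    have "\<bar>exp (- (\<kappa> * \<bar>\<epsilon> * of_int n\<bar>)) - exp (- (\<kappa> * t))\<bar> \<le> \<bar>\<kappa> * \<bar>\<epsilon> * of_int n\<bar> - \<kappa> * t\<bar>"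
      using \<kappa> t by (intro exp_minus_lipschitz mult_nonneg_nonneg) auto
    also have "\<kappa> * \<bar>\<epsilon> * of_int n\<bar> - \<kappa> * t = (\<kappa> * \<epsilon>) * (\<bar>of_int n\<bar> - \<bar>of_int n - 1 / 2\<bar>)"
      using \<epsilon> by (simp only: abs_mult t_def) (simp add: algebra_simps)
    also have "\<bar>\<dots>\<bar> = (\<kappa> * \<epsilon>) * \<bar>\<bar>of_int n\<bar> - \<bar>of_int n - 1 / 2\<bar>\<bar>"
      using \<kappa> \<epsilon> by (simp only: abs_mult abs_of_pos)
    also have "\<dots> \<le> (\<kappa> * \<epsilon>) * (1 / 2)"
    proof (rule mult_left_mono)
      show "\<bar>\<bar>of_int n\<bar> - \<bar>of_int n - 1 / 2\<bar>\<bar> \<le> (1 / 2 :: real)" by linarith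
    qed (use \<kappa> \<epsilon> in simp)
    finally show ?thesis by (simp add: X_def Y_def)
  qed
  moreover have "\<bar>Y - Z\<bar> \<le> 2 / \<kappa> * (N * \<epsilon>)"
  proof -
    have "\<bar>Y - Z\<bar> \<le> 2 / \<kappa> * \<bar>\<kappa> - p\<bar>"
      unfolding Y_def Z_def by (rule exp_rate_lipschitz[OF \<kappa> p t])
    also have "\<dots> \<le> 2 / \<kappa> * (N * \<epsilon>)" using \<kappa> rate by (intro mult_left_mono) auto
    finally show ?thesis .
  qed
  ultimately have "\<bar>m n - Z\<bar> \<le> (L * \<epsilon> + L * \<epsilon>) + \<kappa> / 2 * \<epsilon> + 2 / \<kappa> * (N * \<epsilon>)"
    by linarith
  also have "\<dots> = (2 * L + \<kappa> / 2 + 2 / \<kappa> * N) * \<epsilon>" by (simp add: ring_distribs)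
  also have "Z = exp (- (\<epsilon> * p) * \<bar>of_int n - 1 / 2\<bar>)" by (simp add: Z_def t_def mult_ac)
  finally show ?thesis unfolding L_def N_def .
qed

section \<open>The homogenised equations and the mode\<close>

lemma matrix_vector_mult_row_1: "(M *v vector [a, b] :: real^2) $ 1 = M $ 1 $ 1 * a + M $ 1 $ 2 * b"
  for M :: "real^2^2"
  by (simp add: matrix_vector_mult_def sum_2)

text \<open>The first components of the equations form a closed problem for \<open>u\<^sub>0\<close>. Order \<open>\<epsilon>\<^sup>0\<close> gives
  \<open>(T\<^sub>0)\<^sub>1\<^sub>1 = - 1\<close>, because \<open>u\<^sub>0\<close> is a non-zero distribution; then \<open>u\<^sub>1\<close> drops out at order \<open>\<epsilon>\<^sup>1\<close>, which
  gives \<open>(T\<^sub>1)\<^sub>1\<^sub>1 = 0\<close>, and at order \<open>\<epsilon>\<^sup>2\<close> both \<open>u\<^sub>1\<close> and \<open>u\<^sub>2\<close> drop out.\<close>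

lemma homogenised_first_row:
  assumes eqs: "homogenised_equations \<epsilon> T\<^sub>0 T\<^sub>1 T\<^sub>2 P Q u\<^sub>0 u\<^sub>1 u\<^sub>2 v\<^sub>0 v\<^sub>1"
    and u\<^sub>0: "continuous_on UNIV u\<^sub>0" "u\<^sub>0 z \<noteq> 0" and \<phi>: "test_function \<phi>"
  shows "reg_dist u\<^sub>0 (deriv (deriv \<phi>)) = (- 2 * T\<^sub>2 $ 1 $ 1) * reg_dist u\<^sub>0 \<phi>
       - (P $ 1 $ 1 * u\<^sub>0 0 + P $ 1 $ 2 * v\<^sub>0 0) * \<phi> 0 - (Q $ 1 $ 1 * u\<^sub>0 \<epsilon> - Q $ 1 $ 2 * v\<^sub>0 \<epsilon>) * \<phi> \<epsilon>"
proof -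
  have row0: "- 2 * reg_dist u\<^sub>0 \<psi> = 2 * (T\<^sub>0 $ 1 $ 1 * reg_dist u\<^sub>0 \<psi>)"
    and row1: "- 2 * reg_dist u\<^sub>1 \<psi>
       = 2 * (T\<^sub>0 $ 1 $ 1 * reg_dist u\<^sub>1 \<psi> + T\<^sub>1 $ 1 $ 1 * reg_dist u\<^sub>0 \<psi>)"
    and row2: "- 2 * reg_dist u\<^sub>2 \<psi> - reg_dist u\<^sub>0 (deriv (deriv \<psi>))
       = 2 * (T\<^sub>0 $ 1 $ 1 * reg_dist u\<^sub>2 \<psi> + T\<^sub>1 $ 1 $ 1 * reg_dist u\<^sub>1 \<psi> + T\<^sub>2 $ 1 $ 1 * reg_dist u\<^sub>0 \<psi>)
         + \<psi> 0 * (P $ 1 $ 1 * u\<^sub>0 0 + P $ 1 $ 2 * v\<^sub>0 0)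
         + \<psi> \<epsilon> * (Q $ 1 $ 1 * u\<^sub>0 \<epsilon> - Q $ 1 $ 2 * v\<^sub>0 \<epsilon>)"
    if \<psi>: "test_function \<psi>" for \<psi>
  proof -
    note e = eqs[unfolded homogenised_equations_def, rule_format, OF \<psi>]
    note simps = matrix_vector_mult_row_1 dist_deriv_def dirac_at_def
    show "- 2 * reg_dist u\<^sub>0 \<psi> = 2 * (T\<^sub>0 $ 1 $ 1 * reg_dist u\<^sub>0 \<psi>)"
      using arg_cong[OF e[THEN conjunct1], of "\<lambda>w. w $ 1"] by (simp add: simps)
    show "- 2 * reg_dist u\<^sub>1 \<psi>
       = 2 * (T\<^sub>0 $ 1 $ 1 * reg_dist u\<^sub>1 \<psi> + T\<^sub>1 $ 1 $ 1 * reg_dist u\<^sub>0 \<psi>)"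
      using arg_cong[OF e[THEN conjunct2, THEN conjunct1], of "\<lambda>w. w $ 1"] by (simp add: simps)
    show "- 2 * reg_dist u\<^sub>2 \<psi> - reg_dist u\<^sub>0 (deriv (deriv \<psi>))
       = 2 * (T\<^sub>0 $ 1 $ 1 * reg_dist u\<^sub>2 \<psi> + T\<^sub>1 $ 1 $ 1 * reg_dist u\<^sub>1 \<psi> + T\<^sub>2 $ 1 $ 1 * reg_dist u\<^sub>0 \<psi>)
         + \<psi> 0 * (P $ 1 $ 1 * u\<^sub>0 0 + P $ 1 $ 2 * v\<^sub>0 0)
         + \<psi> \<epsilon> * (Q $ 1 $ 1 * u\<^sub>0 \<epsilon> - Q $ 1 $ 2 * v\<^sub>0 \<epsilon>)"
      using arg_cong[OF e[THEN conjunct2, THEN conjunct2], of "\<lambda>w. w $ 1"] by (simp add: simps)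
  qed
  obtain \<psi> where \<psi>: "test_function \<psi>" "reg_dist u\<^sub>0 \<psi> \<noteq> 0"
    using continuous_nonzero_tested[OF u\<^sub>0] by blast
  have "T\<^sub>0 $ 1 $ 1 = - 1"
  proof -
    have "(T\<^sub>0 $ 1 $ 1 + 1) * reg_dist u\<^sub>0 \<psi> = 0" using row0[OF \<psi>(1)] unfolding distrib_right by linarith
    then show ?thesis using \<psi>(2) by simp
  qed
  moreover from this have "T\<^sub>1 $ 1 $ 1 = 0" using row1[OF \<psi>(1)] \<psi>(2) by simp
  ultimately show ?thesis using row2[OF \<phi>] by (simp add: algebra_simps)
qed

lemma bigo_at_right_bound:
  assumes "f \<in> O[at_right 0](g)"
  obtains C :: real where "\<forall>\<^sub>F \<epsilon> in at_right (0::real). \<bar>f \<epsilon>\<bar> \<le> C * \<bar>g \<epsilon> :: real\<bar>"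
  using assms by (auto simp: bigo_def)

theorem theorem2p7:
  fixes h \<epsilon>\<^sub>0 \<omega>\<^sub>0 \<omega>\<^sub>1 \<omega>\<^sub>2 :: real
    and x :: "real \<Rightarrow> int \<Rightarrow> real"
    and c :: "real \<Rightarrow> real \<Rightarrow> real"
    and cper :: "real \<Rightarrow> real"
    and G :: "real set"
    and \<omega> :: "real \<Rightarrow> real"
    and T :: "real \<Rightarrow> real^2^2"
    and DL DR PL PR :: "real \<Rightarrow> real \<Rightarrow> real^2^2"
    and T\<^sub>1 T\<^sub>2 :: "real^2^2"
    and u v U V u\<^sub>0 u\<^sub>1 u\<^sub>2 v\<^sub>0 v\<^sub>1 v\<^sub>2 :: "real \<Rightarrow> real \<Rightarrow> real"
  assumes eps0: "0 < \<epsilon>\<^sub>0"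
    \<comment> \<open>media with a symmetric defect, one for each \<open>\<epsilon>\<close>, with a common medium without defect\<close>
    and medium: "\<And>\<epsilon>. \<epsilon> \<in> {0<..<\<epsilon>\<^sub>0} \<Longrightarrow> defect_medium h (x \<epsilon>) (c \<epsilon>)"
    and symmetric: "\<And>\<epsilon>. \<epsilon> \<in> {0<..<\<epsilon>\<^sub>0} \<Longrightarrow> symmetric_defect (x \<epsilon>) (c \<epsilon>)"
    and periodic: "\<And>\<epsilon>. \<epsilon> \<in> {0<..<\<epsilon>\<^sub>0} \<Longrightarrow> without_defect h (x \<epsilon>) (c \<epsilon>) = cper"
    \<comment> \<open>localised eigenmodes, normalised on the mesh\<close>
    and eigenmode: "\<And>\<epsilon>. \<epsilon> \<in> {0<..<\<epsilon>\<^sub>0} \<Longrightarrow> localised_eigenmode (c \<epsilon>) (\<omega> \<epsilon>) (u \<epsilon>) (v \<epsilon>)"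
    and gap: "band_gap h cper G" "\<And>\<epsilon>. \<epsilon> \<in> {0<..<\<epsilon>\<^sub>0} \<Longrightarrow> \<omega> \<epsilon> \<in> G"
    and normalised: "\<And>\<epsilon>. \<epsilon> \<in> {0<..<\<epsilon>\<^sub>0} \<Longrightarrow>
          (\<forall>n. \<bar>u \<epsilon> (x \<epsilon> n)\<bar> \<le> 1) \<and> (\<exists>n. \<bar>u \<epsilon> (x \<epsilon> n)\<bar> = 1)"
    \<comment> \<open>transfer matrices and the small perturbation\<close>
    and T: "\<And>\<epsilon> w n. \<epsilon> \<in> {0<..<\<epsilon>\<^sub>0} \<Longrightarrow> n \<noteq> 0 \<Longrightarrow>
          transfer_matrix (c \<epsilon>) w (x \<epsilon> n) (x \<epsilon> (n + 1)) (T w)"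
    and DL: "\<And>\<epsilon> w. \<epsilon> \<in> {0<..<\<epsilon>\<^sub>0} \<Longrightarrow> transfer_matrix (c \<epsilon>) w (x \<epsilon> 0) (x \<epsilon> 1) (DL \<epsilon> w)"
    and DR: "\<And>\<epsilon> w. \<epsilon> \<in> {0<..<\<epsilon>\<^sub>0} \<Longrightarrow> transfer_matrix (c \<epsilon>) w (x \<epsilon> 1) (x \<epsilon> 0) (DR \<epsilon> w)"
    and PL: "\<And>\<epsilon> w. \<epsilon> \<in> {0<..<\<epsilon>\<^sub>0} \<Longrightarrow> \<epsilon> *\<^sub>R PL \<epsilon> w = DL \<epsilon> w - T w"
    and PR: "\<And>\<epsilon> w. \<epsilon> \<in> {0<..<\<epsilon>\<^sub>0} \<Longrightarrow> \<epsilon> *\<^sub>R PR \<epsilon> w = S_mat ** DR \<epsilon> w ** S_mat - T w"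
    and P_order_one: "\<And>i j. (\<lambda>\<epsilon>. PL \<epsilon> (\<omega> \<epsilon>) $ i $ j) \<in> O[at_right 0](\<lambda>_. 1)"
          "\<And>i j. (\<lambda>\<epsilon>. PR \<epsilon> (\<omega> \<epsilon>) $ i $ j) \<in> O[at_right 0](\<lambda>_. 1)"
    \<comment> \<open>ansatz (i)\<close>
    and alternation: "\<And>\<epsilon> n. \<epsilon> \<in> {0<..<\<epsilon>\<^sub>0} \<Longrightarrow>
          u \<epsilon> (x \<epsilon> n) = (- 1) powi n * U \<epsilon> (\<epsilon> * of_int n) \<and>
          v \<epsilon> (x \<epsilon> n) = (- 1) powi n * V \<epsilon> (\<epsilon> * of_int n)"
    \<comment> \<open>ansatz (ii)\<close>
    and u_expansion:
          "unif_O 3 (\<lambda>\<epsilon> \<eta>. U \<epsilon> \<eta> - (u\<^sub>0 \<epsilon> \<eta> + \<epsilon> * u\<^sub>1 \<epsilon> \<eta> + \<epsilon>\<^sup>2 * u\<^sub>2 \<epsilon> \<eta>))"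
    and v_expansion:
          "unif_O 3 (\<lambda>\<epsilon> \<eta>. V \<epsilon> \<eta> - (v\<^sub>0 \<epsilon> \<eta> + \<epsilon> * v\<^sub>1 \<epsilon> \<eta> + \<epsilon>\<^sup>2 * v\<^sub>2 \<epsilon> \<eta>))"
    and long_scale_terms:
          "long_scale {0<..<\<epsilon>\<^sub>0} (\<lambda>_. {}) u\<^sub>0" "long_scale {0<..<\<epsilon>\<^sub>0} (\<lambda>_. {}) u\<^sub>1"
          "long_scale {0<..<\<epsilon>\<^sub>0} (\<lambda>_. {}) u\<^sub>2" "long_scale {0<..<\<epsilon>\<^sub>0} (\<lambda>_. {}) v\<^sub>0"
          "long_scale {0<..<\<epsilon>\<^sub>0} (\<lambda>\<epsilon>. {0, \<epsilon>}) v\<^sub>1" "long_scale {0<..<\<epsilon>\<^sub>0} (\<lambda>\<epsilon>. {0, \<epsilon>}) v\<^sub>2"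
    and u0_nonzero: "\<And>\<epsilon>. \<epsilon> \<in> {0<..<\<epsilon>\<^sub>0} \<Longrightarrow> \<exists>\<eta>. u\<^sub>0 \<epsilon> \<eta> \<noteq> 0"
    \<comment> \<open>ansatz (iii)\<close>
    and edge: "antiperiodic_edge h cper G \<omega>\<^sub>0"
    and omega_expansion:
          "(\<lambda>\<epsilon>. \<omega> \<epsilon> - (\<omega>\<^sub>0 + \<epsilon> * \<omega>\<^sub>1 + \<epsilon>\<^sup>2 * \<omega>\<^sub>2)) \<in> O[at_right 0](\<lambda>\<epsilon>. \<epsilon> ^ 3)"
    and T_expansion: "\<And>i j.
          (\<lambda>\<epsilon>. (T (\<omega> \<epsilon>) - (T \<omega>\<^sub>0 + \<epsilon> *\<^sub>R T\<^sub>1 + \<epsilon>\<^sup>2 *\<^sub>R T\<^sub>2)) $ i $ j) \<in> O[at_right 0](\<lambda>\<epsilon>. \<epsilon> ^ 3)"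
    and P_expansion:
          "\<And>i j. (\<lambda>\<epsilon>. (PL \<epsilon> (\<omega> \<epsilon>) - PL \<epsilon> \<omega>\<^sub>0) $ i $ j) \<in> O[at_right 0](\<lambda>\<epsilon>. \<epsilon>)"
          "\<And>i j. (\<lambda>\<epsilon>. (PR \<epsilon> (\<omega> \<epsilon>) - PR \<epsilon> \<omega>\<^sub>0) $ i $ j) \<in> O[at_right 0](\<lambda>\<epsilon>. \<epsilon>)"
    and T2_sign: "- 2 * T\<^sub>2 $ 1 $ 1 > 0"
    \<comment> \<open>ansatz (iv)\<close>
    and homogenised: "\<And>\<epsilon>. \<epsilon> \<in> {0<..<\<epsilon>\<^sub>0} \<Longrightarrow>
          homogenised_equations \<epsilon> (T \<omega>\<^sub>0) T\<^sub>1 T\<^sub>2 (PL \<epsilon> \<omega>\<^sub>0) (PR \<epsilon> \<omega>\<^sub>0)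
            (u\<^sub>0 \<epsilon>) (u\<^sub>1 \<epsilon>) (u\<^sub>2 \<epsilon>) (v\<^sub>0 \<epsilon>) (v\<^sub>1 \<epsilon>)"
    and absorbed: "\<And>\<epsilon>. \<epsilon> \<in> {0<..<\<epsilon>\<^sub>0} \<Longrightarrow>
          (\<exists>k. \<forall>\<eta>. u\<^sub>1 \<epsilon> \<eta> = k * u\<^sub>0 \<epsilon> \<eta>) \<Longrightarrow> (\<forall>\<eta>. u\<^sub>1 \<epsilon> \<eta> = 0)"
  shows "unif_O 1 (\<lambda>\<epsilon> (n::int).
           let T\<^sub>0 = T \<omega>\<^sub>0; D\<^sub>0\<^sub>L = T\<^sub>0 + \<epsilon> *\<^sub>R PL \<epsilon> \<omega>\<^sub>0
           in \<bar>u \<epsilon> (x \<epsilon> n)\<bar> - exp (- (D\<^sub>0\<^sub>L $ 1 $ 1 - T\<^sub>0 $ 1 $ 1) * \<bar>of_int n - 1 / 2\<bar>))"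
proof -
  define \<kappa> where "\<kappa> = sqrt (- 2 * T\<^sub>2 $ 1 $ 1)"
  have \<kappa>: "0 < \<kappa>" and \<kappa>2: "\<kappa>\<^sup>2 = - 2 * T\<^sub>2 $ 1 $ 1"
    using T2_sign by (simp_all add: \<kappa>_def)
  \<comment> \<open>The first row of the leading-order perturbation matrix, which is the same from either side.\<close>
  define p q where "p \<epsilon> = PL \<epsilon> \<omega>\<^sub>0 $ 1 $ 1" and "q \<epsilon> = PL \<epsilon> \<omega>\<^sub>0 $ 1 $ 2" for \<epsilon>
  have PR_eq: "PR \<epsilon> \<omega>\<^sub>0 = PL \<epsilon> \<omega>\<^sub>0" if \<epsilon>: "\<epsilon> \<in> {0<..<\<epsilon>\<^sub>0}" for \<epsilon>
  proof -
    have "DL \<epsilon> \<omega>\<^sub>0 = S_mat ** DR \<epsilon> \<omega>\<^sub>0 ** S_mat"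
      by (rule defect_transfer_matrix_symmetric[OF medium symmetric DL DR]) fact+
    then have "\<epsilon> *\<^sub>R PR \<epsilon> \<omega>\<^sub>0 = \<epsilon> *\<^sub>R PL \<epsilon> \<omega>\<^sub>0" by (simp add: PL[OF \<epsilon>] PR[OF \<epsilon>])
    then show ?thesis using \<epsilon> by simp
  qed
  have u0_formula: "u\<^sub>0 \<epsilon> y = (p \<epsilon> * u\<^sub>0 \<epsilon> 0 + q \<epsilon> * v\<^sub>0 \<epsilon> 0) / (2 * \<kappa>) * exp (- \<kappa> * \<bar>y - 0\<bar>)
      + (p \<epsilon> * u\<^sub>0 \<epsilon> \<epsilon> - q \<epsilon> * v\<^sub>0 \<epsilon> \<epsilon>) / (2 * \<kappa>) * exp (- \<kappa> * \<bar>y - \<epsilon>\<bar>)"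
    if \<epsilon>: "\<epsilon> \<in> {0<..<\<epsilon>\<^sub>0}" for \<epsilon> y
  proof -
    have ls: "continuous_on UNIV (u\<^sub>0 \<epsilon>)" "(u\<^sub>0 \<epsilon> \<longlongrightarrow> 0) at_top" "(u\<^sub>0 \<epsilon> \<longlongrightarrow> 0) at_bot"
      using long_scale_terms(1) \<epsilon> by (auto simp: long_scale_def)
    obtain z where z: "u\<^sub>0 \<epsilon> z \<noteq> 0" using u0_nonzero[OF \<epsilon>] by blast
    show ?thesis
    proof (rule delta_forced_solution[OF ls \<kappa>])
      fix \<phi> :: "real \<Rightarrow> real" assume "test_function \<phi>"
      from homogenised_first_row[OF homogenised[OF \<epsilon>] ls(1) z this]
      show "reg_dist (u\<^sub>0 \<epsilon>) (deriv (deriv \<phi>)) = \<kappa>\<^sup>2 * reg_dist (u\<^sub>0 \<epsilon>) \<phi>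
          - (p \<epsilon> * u\<^sub>0 \<epsilon> 0 + q \<epsilon> * v\<^sub>0 \<epsilon> 0) * \<phi> 0 - (p \<epsilon> * u\<^sub>0 \<epsilon> \<epsilon> - q \<epsilon> * v\<^sub>0 \<epsilon> \<epsilon>) * \<phi> \<epsilon>"
        by (simp only: \<kappa>2 p_def q_def PR_eq[OF \<epsilon>])
    qed
  qed
  obtain K :: real where K: "1 \<le> K" and bounds: "\<forall>\<^sub>F \<epsilon> in at_right 0. \<epsilon> \<in> {0<..<\<epsilon>\<^sub>0} \<and>
      \<bar>p \<epsilon>\<bar> \<le> K \<and> \<bar>q \<epsilon>\<bar> \<le> K \<and> (\<forall>\<eta>. \<bar>u\<^sub>0 \<epsilon> \<eta>\<bar> \<le> K) \<and> (\<forall>\<eta>. \<bar>v\<^sub>0 \<epsilon> \<eta>\<bar> \<le> K) \<and>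
      \<bar>u\<^sub>0 \<epsilon> 0 - u\<^sub>0 \<epsilon> \<epsilon>\<bar> \<le> K * \<epsilon> \<and> \<bar>v\<^sub>0 \<epsilon> 0 - v\<^sub>0 \<epsilon> \<epsilon>\<bar> \<le> K * \<epsilon> \<and>
      (\<forall>\<eta>. \<bar>U \<epsilon> \<eta> - u\<^sub>0 \<epsilon> \<eta>\<bar> \<le> K * \<epsilon>)"
  proof -
    obtain c1 where c1: "\<forall>\<^sub>F \<epsilon> in at_right 0. \<bar>PL \<epsilon> (\<omega> \<epsilon>) $ 1 $ 1\<bar> \<le> c1"
      using bigo_at_right_bound[OF P_order_one(1)[of 1 1]] by auto
    obtain c2 where c2: "\<forall>\<^sub>F \<epsilon> in at_right 0. \<bar>(PL \<epsilon> (\<omega> \<epsilon>) - PL \<epsilon> \<omega>\<^sub>0) $ 1 $ 1\<bar> \<le> c2 * \<bar>\<epsilon>\<bar>"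
      using bigo_at_right_bound[OF P_expansion(1)[of 1 1]] by blast
    obtain c3 where c3: "\<forall>\<^sub>F \<epsilon> in at_right 0. \<bar>PL \<epsilon> (\<omega> \<epsilon>) $ 1 $ 2\<bar> \<le> c3"
      using bigo_at_right_bound[OF P_order_one(1)[of 1 2]] by auto
    obtain c4 where c4: "\<forall>\<^sub>F \<epsilon> in at_right 0. \<bar>(PL \<epsilon> (\<omega> \<epsilon>) - PL \<epsilon> \<omega>\<^sub>0) $ 1 $ 2\<bar> \<le> c4 * \<bar>\<epsilon>\<bar>"
      using bigo_at_right_bound[OF P_expansion(1)[of 1 2]] by blast
    have order_one: "\<exists>C. \<forall>\<^sub>F \<epsilon> in at_right 0. \<forall>\<eta>. \<bar>f \<epsilon> \<eta>\<bar> \<le> C"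
      if "long_scale {0<..<\<epsilon>\<^sub>0} J f" for J f
      using that by (simp add: long_scale_def unif_O_def)
    obtain c5 where c5: "\<forall>\<^sub>F \<epsilon> in at_right 0. \<forall>\<eta>. \<bar>u\<^sub>0 \<epsilon> \<eta>\<bar> \<le> c5"
      using order_one[OF long_scale_terms(1)] by blast
    obtain c6 where c6: "\<forall>\<^sub>F \<epsilon> in at_right 0. \<forall>\<eta>. \<bar>u\<^sub>1 \<epsilon> \<eta>\<bar> \<le> c6"
      using order_one[OF long_scale_terms(2)] by blast
    obtain c7 where c7: "\<forall>\<^sub>F \<epsilon> in at_right 0. \<forall>\<eta>. \<bar>u\<^sub>2 \<epsilon> \<eta>\<bar> \<le> c7"
      using order_one[OF long_scale_terms(3)] by blast
    obtain c8 where c8: "\<forall>\<^sub>F \<epsilon> in at_right 0. \<forall>\<eta>. \<bar>v\<^sub>0 \<epsilon> \<eta>\<bar> \<le> c8"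
      using order_one[OF long_scale_terms(4)] by blast
    obtain c9 where c9: "\<forall>\<^sub>F \<epsilon> in at_right 0. \<forall>\<eta>.
        \<bar>U \<epsilon> \<eta> - (u\<^sub>0 \<epsilon> \<eta> + \<epsilon> * u\<^sub>1 \<epsilon> \<eta> + \<epsilon>\<^sup>2 * u\<^sub>2 \<epsilon> \<eta>)\<bar> \<le> c9 * \<epsilon> ^ 3"
      using u_expansion by (auto simp: unif_O_def)
    have slow: "\<exists>C. \<forall>\<^sub>F \<epsilon> in at_right 0. \<forall>\<eta> \<eta>'. \<bar>\<eta> - \<eta>'\<bar> \<le> \<epsilon> \<longrightarrow> \<bar>f \<epsilon> \<eta> - f \<epsilon> \<eta>'\<bar> \<le> C * \<epsilon>"
      if "long_scale {0<..<\<epsilon>\<^sub>0} (\<lambda>_. {}) f" for f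
      using that[unfolded long_scale_def, THEN conjunct2, THEN conjunct2, THEN spec, of 1] by simp
    obtain c10 where c10: "\<forall>\<^sub>F \<epsilon> in at_right 0. \<forall>\<eta> \<eta>'. \<bar>\<eta> - \<eta>'\<bar> \<le> \<epsilon> \<longrightarrow> \<bar>u\<^sub>0 \<epsilon> \<eta> - u\<^sub>0 \<epsilon> \<eta>'\<bar> \<le> c10 * \<epsilon>"
      using slow[OF long_scale_terms(1)] by blast
    obtain c11 where c11: "\<forall>\<^sub>F \<epsilon> in at_right 0. \<forall>\<eta> \<eta>'. \<bar>\<eta> - \<eta>'\<bar> \<le> \<epsilon> \<longrightarrow> \<bar>v\<^sub>0 \<epsilon> \<eta> - v\<^sub>0 \<epsilon> \<eta>'\<bar> \<le> c11 * \<epsilon>"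
      using slow[OF long_scale_terms(4)] by blast
    define K where "K = 1 + \<bar>c1\<bar> + \<bar>c2\<bar> + \<bar>c3\<bar> + \<bar>c4\<bar> + \<bar>c5\<bar> + \<bar>c6\<bar> + \<bar>c7\<bar> + \<bar>c8\<bar> + \<bar>c9\<bar> + \<bar>c10\<bar> + \<bar>c11\<bar>"
    have Kge: "1 \<le> K" "\<bar>c1\<bar> + \<bar>c2\<bar> \<le> K" "\<bar>c3\<bar> + \<bar>c4\<bar> \<le> K" "\<bar>c6\<bar> + \<bar>c7\<bar> + \<bar>c9\<bar> \<le> K"
      "\<bar>c5\<bar> \<le> K" "\<bar>c8\<bar> \<le> K" "\<bar>c10\<bar> \<le> K" "\<bar>c11\<bar> \<le> K"
      unfolding K_def by simp_all
    note Kge' = Kge(5-8)[THEN order_trans[OF abs_ge_self]]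
    \<comment> \<open>\<open>s\<close> is an entry at the frequency \<open>\<omega>\<close> of the mode, \<open>r\<close> the same entry at the band-gap edge.\<close>
    have entry: "\<bar>r\<bar> \<le> K" if "\<bar>s\<bar> \<le> a" "\<bar>s - r\<bar> \<le> b * \<bar>\<epsilon>\<bar>" "0 < \<epsilon>" "\<epsilon> < 1" "\<bar>a\<bar> + \<bar>b\<bar> \<le> K"
      for r s a b \<epsilon> :: real
    proof -
      have "b * \<bar>\<epsilon>\<bar> \<le> \<bar>b\<bar> * 1" using that by (intro mult_mono) auto
      then show ?thesis using that by linarith
    qed
    show ?thesis
    proof (rule that[OF Kge(1)])
      have "\<forall>\<^sub>F \<epsilon> in at_right 0. \<epsilon> \<in> {0<..<min 1 \<epsilon>\<^sub>0}"
        by (rule eventually_at_right_real) (simp add: eps0)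
      then show "\<forall>\<^sub>F \<epsilon> in at_right 0. \<epsilon> \<in> {0<..<\<epsilon>\<^sub>0} \<and>
        \<bar>p \<epsilon>\<bar> \<le> K \<and> \<bar>q \<epsilon>\<bar> \<le> K \<and> (\<forall>\<eta>. \<bar>u\<^sub>0 \<epsilon> \<eta>\<bar> \<le> K) \<and> (\<forall>\<eta>. \<bar>v\<^sub>0 \<epsilon> \<eta>\<bar> \<le> K) \<and>
        \<bar>u\<^sub>0 \<epsilon> 0 - u\<^sub>0 \<epsilon> \<epsilon>\<bar> \<le> K * \<epsilon> \<and> \<bar>v\<^sub>0 \<epsilon> 0 - v\<^sub>0 \<epsilon> \<epsilon>\<bar> \<le> K * \<epsilon> \<and>
        (\<forall>\<eta>. \<bar>U \<epsilon> \<eta> - u\<^sub>0 \<epsilon> \<eta>\<bar> \<le> K * \<epsilon>)"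
        using c1 c2 c3 c4 c5 c6 c7 c8 c9 c10 c11
      proof eventually_elim
        case (elim \<epsilon>)
        have \<epsilon>: "0 < \<epsilon>" "\<epsilon> < 1" "\<epsilon> < \<epsilon>\<^sub>0" using elim(1) by auto
        have "\<bar>p \<epsilon>\<bar> \<le> K" "\<bar>q \<epsilon>\<bar> \<le> K"
          using entry[OF elim(2) _ \<epsilon>(1,2) Kge(2)] entry[OF elim(4) _ \<epsilon>(1,2) Kge(3)] elim(3,5)
          by (simp_all add: p_def q_def)
        moreover have "\<bar>u\<^sub>0 \<epsilon> \<eta>\<bar> \<le> K" "\<bar>v\<^sub>0 \<epsilon> \<eta>\<bar> \<le> K" for \<eta>
          using order_trans[OF _ Kge'(1)] order_trans[OF _ Kge'(2)] elim(6,9) by blast+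
        moreover have "\<bar>u\<^sub>0 \<epsilon> 0 - u\<^sub>0 \<epsilon> \<epsilon>\<bar> \<le> K * \<epsilon>"
          by (rule order_trans[OF elim(11)[rule_format] mult_right_mono[OF Kge'(3)]]) (use \<epsilon> in auto)
        moreover have "\<bar>v\<^sub>0 \<epsilon> 0 - v\<^sub>0 \<epsilon> \<epsilon>\<bar> \<le> K * \<epsilon>"
          by (rule order_trans[OF elim(12)[rule_format] mult_right_mono[OF Kge'(4)]]) (use \<epsilon> in auto)
        moreover have "\<bar>U \<epsilon> \<eta> - u\<^sub>0 \<epsilon> \<eta>\<bar> \<le> K * \<epsilon>" for \<eta>
        proof -
          have e: "\<epsilon>\<^sup>2 \<le> \<epsilon>" "\<epsilon> ^ 3 \<le> \<epsilon>"
            using power_decreasing[of 1 2 \<epsilon>] power_decreasing[of 1 3 \<epsilon>] \<epsilon> by simp_all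
          have "\<bar>\<epsilon> * u\<^sub>1 \<epsilon> \<eta>\<bar> \<le> \<epsilon> * \<bar>c6\<bar>" "\<bar>\<epsilon>\<^sup>2 * u\<^sub>2 \<epsilon> \<eta>\<bar> \<le> \<epsilon> * \<bar>c7\<bar>" "c9 * \<epsilon> ^ 3 \<le> \<bar>c9\<bar> * \<epsilon>"
          proof -
            have "\<bar>u\<^sub>1 \<epsilon> \<eta>\<bar> \<le> \<bar>c6\<bar>" "\<bar>u\<^sub>2 \<epsilon> \<eta>\<bar> \<le> \<bar>c7\<bar>"
              using elim(7,8) by (meson abs_ge_self order_trans)+
            then show "\<bar>\<epsilon> * u\<^sub>1 \<epsilon> \<eta>\<bar> \<le> \<epsilon> * \<bar>c6\<bar>" "\<bar>\<epsilon>\<^sup>2 * u\<^sub>2 \<epsilon> \<eta>\<bar> \<le> \<epsilon> * \<bar>c7\<bar>"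
              unfolding abs_mult using \<epsilon> e by (auto intro!: mult_mono)
            show "c9 * \<epsilon> ^ 3 \<le> \<bar>c9\<bar> * \<epsilon>" using \<epsilon> e by (intro mult_mono) auto
          qed
          moreover have "\<bar>U \<epsilon> \<eta> - (u\<^sub>0 \<epsilon> \<eta> + \<epsilon> * u\<^sub>1 \<epsilon> \<eta> + \<epsilon>\<^sup>2 * u\<^sub>2 \<epsilon> \<eta>)\<bar> \<le> c9 * \<epsilon> ^ 3"
            using elim(10) by blast
          ultimately have "\<bar>U \<epsilon> \<eta> - u\<^sub>0 \<epsilon> \<eta>\<bar> \<le> \<epsilon> * \<bar>c6\<bar> + \<epsilon> * \<bar>c7\<bar> + \<bar>c9\<bar> * \<epsilon>"
            by linarith
          also have "\<dots> = (\<bar>c6\<bar> + \<bar>c7\<bar> + \<bar>c9\<bar>) * \<epsilon>" by (simp add: algebra_simps)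
          also have "\<dots> \<le> K * \<epsilon>" using Kge(4) \<epsilon> by (intro mult_right_mono) auto
          finally show ?thesis .
        qed
        ultimately show ?case using \<epsilon> by simp
      qed
    qed
  qed
  \<comment> \<open>\<open>M\<close> and \<open>N\<close> bound the errors of the amplitude and of the rate, divided by \<open>\<epsilon>\<close>.\<close>
  define M N where "M = K + K\<^sup>2" and "N = 2 * K ^ 3 + 2 * K\<^sup>2"
  have MN: "0 < M" "0 < N" using K by (simp_all add: M_def N_def add_pos_pos)
  have "\<forall>\<^sub>F \<epsilon> in at_right 0. \<epsilon> \<in> {0<..<min (1 / (2 * M)) (\<kappa> / (2 * N))}"
    by (rule eventually_at_right_real) (use MN \<kappa> in simp)
  then have "\<forall>\<^sub>F \<epsilon> in at_right 0. \<forall>n::int.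
      \<bar>\<bar>u \<epsilon> (x \<epsilon> n)\<bar> - exp (- (\<epsilon> * p \<epsilon>) * \<bar>of_int n - 1 / 2\<bar>)\<bar>
      \<le> (2 * M + \<kappa> / 2 + 2 / \<kappa> * N) * \<epsilon>"
    using bounds
  proof eventually_elim
    case (elim \<epsilon>)
    have \<epsilon>: "\<epsilon> \<in> {0<..<\<epsilon>\<^sub>0}" using elim(2) by blast
    have small: "(K + K\<^sup>2) * \<epsilon> \<le> 1 / 2" "(2 * K ^ 3 + 2 * K\<^sup>2) * \<epsilon> \<le> \<kappa> / 2"
    proof -
      have "\<epsilon> < 1 / (2 * M)" "\<epsilon> < \<kappa> / (2 * N)" using elim(1) by simp_all
      then have "\<epsilon> * (2 * M) < 1" "\<epsilon> * (2 * N) < \<kappa>"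
        using MN by (simp_all only: pos_less_divide_eq zero_less_mult_iff zero_less_numeral simp_thms)
      then show "(K + K\<^sup>2) * \<epsilon> \<le> 1 / 2" "(2 * K ^ 3 + 2 * K\<^sup>2) * \<epsilon> \<le> \<kappa> / 2"
        unfolding M_def[symmetric] N_def[symmetric] by (simp_all add: mult_ac)
    qed
    have mesh: "\<bar>\<bar>u \<epsilon> (x \<epsilon> n)\<bar> - \<bar>u\<^sub>0 \<epsilon> (\<epsilon> * of_int n)\<bar>\<bar> \<le> K * \<epsilon>" for n
    proof -
      have "\<bar>u \<epsilon> (x \<epsilon> n)\<bar> = \<bar>U \<epsilon> (\<epsilon> * of_int n)\<bar>"
        using alternation[OF \<epsilon>, of n] by (simp add: abs_mult power_int_abs)
      then show ?thesis
        using elim(2) abs_triangle_ineq3[of "U \<epsilon> (\<epsilon> * of_int n)" "u\<^sub>0 \<epsilon> (\<epsilon> * of_int n)"]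
        by (metis order_trans)
    qed
    have "0 < \<epsilon>" using \<epsilon> by simp
    then show ?case
      unfolding M_def N_def
      using mode_estimate[OF \<kappa> _ K u0_formula[OF \<epsilon>] refl refl _ _ _ _ _ _ mesh _ _ small]
        elim(2) normalised[OF \<epsilon>] by blast
  qed
  then have "\<forall>\<^sub>F \<epsilon> in at_right 0. \<forall>n::int.
      \<bar>\<bar>u \<epsilon> (x \<epsilon> n)\<bar> - exp (- ((T \<omega>\<^sub>0 + \<epsilon> *\<^sub>R PL \<epsilon> \<omega>\<^sub>0) $ 1 $ 1 - T \<omega>\<^sub>0 $ 1 $ 1) * \<bar>of_int n - 1 / 2\<bar>)\<bar>
      \<le> (2 * M + \<kappa> / 2 + 2 / \<kappa> * N) * \<epsilon> ^ 1"
    by (simp add: p_def)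
  then show ?thesis unfolding unif_O_def Let_def by blast
qed

end
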